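(* Let $d\ge 1$. The action of $\overline{\Gamma}$ on $AC_0(I,\mathbb{R}^d)$ is continuous, i.e. the map $$AC_0(I,\mathbb{R}^d) \times \overline{\Gamma} \to AC_0(I,\mathbb{R}^d), \quad (c,\gamma) \mapsto c \circ \gamma$$ is (jointly) continuous.
   Context: $I=[0,1]$. $AC_0(I,\mathbb{R}^d)$ is the Banach space of absolutely continuous curves $c : I \to \mathbb{R}^d$ with $c(0)=0$, with norm $\|c\|_{AC} = \|c'\|_{L^1}$. $\overline{\Gamma}$ is the semigroup of absolutely continuous $\gamma : I\to I$ with $\gamma(0)=0$, $\gamma(1)=1$, $\gamma'\ge 0$ a.e., endowed with the topology induced from $AC_0(I,\mathbb{R})$. *)

theory Defs
  imports "HOL-Analysis.Analysis"
begin

abbreviation unit_interval :: "real set" (\<open>I01\<close>)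
  where "I01 \<equiv> {0..1}"

text \<open>
  The usual epsilon-delta definition.  A \<open>division_of\<close> is a finite family of nonempty compact
  intervals with pairwise disjoint interiors; it has to fill only some subset \<open>T\<close> of \<open>S\<close>.
  The end points of a member \<open>K\<close> are \<open>Inf K\<close> and \<open>Sup K\<close>.
\<close>

definition abs_continuous_on :: "real set \<Rightarrow> (real \<Rightarrow> 'a::real_normed_vector) \<Rightarrow> bool"
  where "abs_continuous_on S f \<longleftrightarrow>
    (\<forall>\<epsilon>>0. \<exists>\<delta>>0. \<forall>D T. D division_of T \<and> T \<subseteq> S \<and> (\<Sum>K\<in>D. Sup K - Inf K) < \<delta>
        \<longrightarrow> (\<Sum>K\<in>D. norm (f (Sup K) - f (Inf K))) < \<epsilon>)"

text \<open>
  A curve on \<open>[0,1]\<close> is an extensional function (it is \<open>undefined\<close> off \<open>[0,1]\<close>),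
  so that two curves are equal iff they agree on \<open>[0,1]\<close>.
\<close>

definition AC0 :: "(real \<Rightarrow> 'a::euclidean_space) set"
  where "AC0 = {c \<in> extensional I01. abs_continuous_on I01 c \<and> c 0 = 0}"

text \<open>
  An absolutely continuous curve has a derivative at almost every point of \<open>[0,1]\<close>; on the
  remaining null set the value of \<^const>\<open>vector_derivative\<close> is arbitrary and does not affect
  the integral.  Taking derivatives within \<open>[0,1]\<close> makes the values off \<open>[0,1]\<close> irrelevant,
  so \<open>AC_dist\<close> may use the plain pointwise difference.
\<close>

definition AC_norm :: "(real \<Rightarrow> 'a::euclidean_space) \<Rightarrow> real"
  where "AC_norm c = (\<integral>t. norm (vector_derivative c (at t within I01)) \<partial>lebesgue_on I01)"

definition AC_dist :: "(real \<Rightarrow> 'a::euclidean_space) \<Rightarrow> (real \<Rightarrow> 'a) \<Rightarrow> real"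
  where "AC_dist c e = AC_norm (\<lambda>t. c t - e t)"

definition AC0_topology :: "(real \<Rightarrow> 'a::euclidean_space) topology"
  where "AC0_topology = Metric_space.mtopology AC0 AC_dist"

definition Gamma_bar :: "(real \<Rightarrow> real) set"
  where "Gamma_bar = {\<gamma> \<in> I01 \<rightarrow>\<^sub>E I01. abs_continuous_on I01 \<gamma> \<and> \<gamma> 0 = 0 \<and> \<gamma> 1 = 1 \<and>
    (AE t in lebesgue_on I01. 0 \<le> vector_derivative \<gamma> (at t within I01))}"

definition Gamma_bar_topology :: "(real \<Rightarrow> real) topology"
  where "Gamma_bar_topology = subtopology AC0_topology Gamma_bar"

end

theory Submission
  imports Defs
begin

text \<open>
  The norm of an absolutely continuous curve, the \<open>L\<^sup>1\<close> norm
  of its derivative, is its total variation (\<open>AC_norm_eq_total_variation\<close>).  A monotone \<open>\<gamma>\<close> carries chains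
  of points to chains of points, so \<open>c \<mapsto> c \<circ> \<gamma>\<close> never increases the norm (\<open>Gamma_bar_compose\<close>).
  Hence replacing \<open>c\<close> by a nearby curve costs little, uniformly in \<open>\<gamma>\<close>, and it remains to move \<open>\<gamma>\<close> while \<open>c\<close> is fixed.

  By the same uniformity, \<open>c\<close> may then be replaced by a curve \<open>p\<close> with a continuous derivative that is close
  to \<open>c\<close> in norm (\<open>AC_approx_smooth\<close>).  For such \<open>p\<close> the chain rule holds wherever \<open>\<gamma>\<close> is differentiable, and
    \<open>(p \<circ> \<gamma>)' - (p \<circ> \<eta>)' = (\<gamma>' - \<eta>') p'(\<gamma>) + \<eta>' (p'(\<gamma>) - p'(\<eta>))\<close>.
  The \<open>L\<^sup>1\<close> norm of the right-hand side is at most the maximum of \<open>|p'|\<close> times the distance of \<open>\<gamma>\<close> and \<open>\<eta>\<close>,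
  plus the maximum of \<open>|p'(\<gamma>) - p'(\<eta>)|\<close>, since \<open>\<eta>' \<ge> 0\<close> has integral \<open>1\<close> (\<open>AC_norm_compose_diff_le\<close>).
  Both terms become small, because the norm dominates the uniform distance and \<open>p'\<close> is uniformly
  continuous.

  What carries these steps, and even the fact that the norm separates curves, is Lebesgue's
  fundamental theorem of calculus (\<open>abs_continuous_on_fundamental\<close>): an absolutely continuous curve is
  differentiable almost everywhere and is the integral of its derivative.  Its total variation function \<open>V\<close>
  is absolutely continuous and so are the monotone functions \<open>V + c \<bullet> b\<close>; the Stieltjes measure of a
  monotone absolutely continuous function has a density by the theorem of Radon and Nikodym; so \<open>c\<close>
  is an indefinite integral, and such integrals can be differentiated almost everywhere.
\<close>

section \<open>Absolutely continuous functions on the line\<close>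

lemma division_of_real_interval:
  fixes K :: "real set"
  assumes "D division_of T" "K \<in> D"
  shows "Inf K \<le> Sup K" "K = {Inf K..Sup K}" "{Inf K..Sup K} \<subseteq> T" "Inf K \<in> T" "Sup K \<in> T"
proof -
  obtain a b where K: "K = cbox a b" "K \<noteq> {}" "K \<subseteq> T"
    using cbox_division_memE[OF assms(2,1)] by metis
  then have "a \<le> b" by auto
  then show "Inf K \<le> Sup K" "K = {Inf K..Sup K}" "{Inf K..Sup K} \<subseteq> T" "Inf K \<in> T" "Sup K \<in> T"
    using K by auto
qed

text \<open>
  Members of a division may be single points, and such a point may lie inside another member.  Only
  nondegenerate members are ordered along the line.
\<close>

lemma division_of_real_ordered:
  fixes K L :: "real set"
  assumes D: "D division_of T" "K \<in> D" "L \<in> D" "K \<noteq> L" and ne: "Inf K < Sup K" "Inf L < Sup L"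
  shows "Sup K \<le> Inf L \<or> Sup L \<le> Inf K"
proof (rule ccontr)
  assume "\<not> ?thesis"
  then have lt: "max (Inf K) (Inf L) < min (Sup K) (Sup L)"
    using ne by auto
  then obtain m where m: "max (Inf K) (Inf L) < m" "m < min (Sup K) (Sup L)"
    using dense by blast
  have "m \<in> interior {Inf K..Sup K}" "m \<in> interior {Inf L..Sup L}"
    using m by (auto simp: interior_atLeastAtMost_real)
  then have "m \<in> interior K \<inter> interior L"
    using division_of_real_interval(2)[OF D(1)] D by auto
  then show False
    using division_ofD(5)[OF D] by auto
qed

text \<open>
  Absolute continuity is stated with divisions, which are sets of intervals.  Images and refinements of
  intervals are more conveniently handled as indexed families: they may contain repeated or degenerate
  intervals, whose increments vanish.
\<close>

definition nonoverlapping_in :: "real set \<Rightarrow> 'i set \<Rightarrow> ('i \<Rightarrow> real) \<Rightarrow> ('i \<Rightarrow> real) \<Rightarrow> bool" where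
  "nonoverlapping_in S J a b \<longleftrightarrow>
    finite J \<and> (\<forall>j\<in>J. a j \<le> b j \<and> {a j..b j} \<subseteq> S) \<and>
    (\<forall>i\<in>J. \<forall>j\<in>J. i \<noteq> j \<longrightarrow> a i < b i \<longrightarrow> a j < b j \<longrightarrow> b i \<le> a j \<or> b j \<le> a i)"

lemma nonoverlapping_inI:
  assumes "finite J" "\<And>j. j \<in> J \<Longrightarrow> a j \<le> b j" "\<And>j. j \<in> J \<Longrightarrow> {a j..b j} \<subseteq> S"
    "\<And>i j. \<lbrakk>i \<in> J; j \<in> J; i \<noteq> j; a i < b i; a j < b j\<rbrakk> \<Longrightarrow> b i \<le> a j \<or> b j \<le> a i"
  shows "nonoverlapping_in S J a b"
  using assms by (simp add: nonoverlapping_in_def)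

lemma abs_continuous_on_nonoverlapping:
  assumes "abs_continuous_on S f" "e > 0"
  obtains d where "d > 0"
    "\<And>J a b. \<lbrakk>nonoverlapping_in S J a b; (\<Sum>j\<in>J. b j - a j) < d\<rbrakk>
      \<Longrightarrow> (\<Sum>j\<in>J. norm (f (b j) - f (a j))) < e"
proof -
  obtain d where d: "d > 0" and *: "\<And>D T. D division_of T \<and> T \<subseteq> S \<and> (\<Sum>K\<in>D. Sup K - Inf K) < d
        \<Longrightarrow> (\<Sum>K\<in>D. norm (f (Sup K) - f (Inf K))) < e"
    using assms unfolding abs_continuous_on_def by metis
  show thesis
  proof (rule that[OF d])
    fix J and a b :: "_ \<Rightarrow> real"
    assume J: "nonoverlapping_in S J a b" and small: "(\<Sum>j\<in>J. b j - a j) < d"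
    then have fin: "finite J" and le: "\<And>j. j \<in> J \<Longrightarrow> a j \<le> b j"
      and sub: "\<And>j. j \<in> J \<Longrightarrow> {a j..b j} \<subseteq> S"
      and ord: "\<And>i j. \<lbrakk>i \<in> J; j \<in> J; i \<noteq> j; a i < b i; a j < b j\<rbrakk> \<Longrightarrow> b i \<le> a j \<or> b j \<le> a i"
      unfolding nonoverlapping_in_def by blast+
    define J' where "J' = {j \<in> J. a j < b j}"
    define I where "I = (\<lambda>j. {a j..b j})"
    have fin': "finite J'" using fin by (simp add: J'_def)
    have inj: "inj_on I J'"
    proof (rule inj_onI)
      fix i j assume *: "i \<in> J'" "j \<in> J'" "I i = I j"
      then have "a i = a j" "b i = b j"
        by (auto simp: I_def J'_def Icc_eq_Icc)
      then show "i = j"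
        using ord[of i j] * by (auto simp: J'_def)
    qed
    have div: "(I ` J') division_of (\<Union>(I ` J'))"
    proof (rule division_ofI)
      fix K L assume "K \<in> I ` J'" "L \<in> I ` J'" "K \<noteq> L"
      then obtain i j where ij: "i \<in> J'" "j \<in> J'" "K = I i" "L = I j" "i \<noteq> j" by auto
      then have "b i \<le> a j \<or> b j \<le> a i"
        using ord by (auto simp: J'_def)
      then show "interior K \<inter> interior L = {}"
        using ij by (auto simp: I_def interior_atLeastAtMost_real)
    next
      fix K assume "K \<in> I ` J'"
      then show "K \<noteq> {}" "\<exists>a b. K = cbox a b"
        by (auto simp: I_def J'_def)
    qed (use fin' in auto)
    have sub': "\<Union>(I ` J') \<subseteq> S"
      using sub by (auto simp: I_def J'_def)
    have Inf_Sup: "Inf (I j) = a j" "Sup (I j) = b j" if "j \<in> J'" for j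
      using that by (auto simp: I_def J'_def)
    have "(\<Sum>K\<in>I ` J'. Sup K - Inf K) = (\<Sum>j\<in>J'. b j - a j)"
      by (simp add: sum.reindex[OF inj] Inf_Sup)
    also have "\<dots> \<le> (\<Sum>j\<in>J. b j - a j)"
      by (rule sum_mono2) (use fin le in \<open>auto simp: J'_def\<close>)
    finally have "(\<Sum>K\<in>I ` J'. Sup K - Inf K) < d" using small by simp
    with div sub' have "(\<Sum>K\<in>I ` J'. norm (f (Sup K) - f (Inf K))) < e"
      using * by blast
    then have "(\<Sum>j\<in>J'. norm (f (b j) - f (a j))) < e"
      by (simp add: sum.reindex[OF inj] Inf_Sup)
    moreover have "(\<Sum>j\<in>J'. norm (f (b j) - f (a j))) = (\<Sum>j\<in>J. norm (f (b j) - f (a j)))"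
      by (rule sum.mono_neutral_left) (use fin le in \<open>force simp: J'_def less_le\<close>)+
    ultimately show "(\<Sum>j\<in>J. norm (f (b j) - f (a j))) < e" by simp
  qed
qed

text \<open>
  Only increments over intervals inside \<open>S\<close> enter the definition, so a bound on increments transfers
  absolute continuity.
\<close>

lemma abs_continuous_on_dominated:
  assumes "abs_continuous_on S g"
    and "\<And>s t. \<lbrakk>s \<le> t; {s..t} \<subseteq> S\<rbrakk> \<Longrightarrow> norm (f t - f s) \<le> C * norm (g t - g s)"
  shows "abs_continuous_on S f"
  unfolding abs_continuous_on_def
proof (intro allI impI)
  fix e :: real assume e: "e > 0"
  define C' where "C' = max C 1"
  have C': "C' > 0" "C \<le> C'" by (auto simp: C'_def)
  then have "e / C' > 0" using e by simp
  with assms(1) obtain d where "d > 0" and *: "\<And>D T. D division_of T \<and> T \<subseteq> S \<and> (\<Sum>K\<in>D. Sup K - Inf K) < d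
        \<Longrightarrow> (\<Sum>K\<in>D. norm (g (Sup K) - g (Inf K))) < e / C'"
    unfolding abs_continuous_on_def by metis
  moreover have "(\<Sum>K\<in>D. norm (f (Sup K) - f (Inf K))) < e"
    if D: "D division_of T \<and> T \<subseteq> S \<and> (\<Sum>K\<in>D. Sup K - Inf K) < d" for D T
  proof -
    have "(\<Sum>K\<in>D. norm (f (Sup K) - f (Inf K))) \<le> (\<Sum>K\<in>D. C' * norm (g (Sup K) - g (Inf K)))"
    proof (rule sum_mono)
      fix K assume K: "K \<in> D"
      have "norm (f (Sup K) - f (Inf K)) \<le> C * norm (g (Sup K) - g (Inf K))"
        using assms(2) division_of_real_interval[OF _ K] D by (metis order.trans)
      also have "\<dots> \<le> C' * norm (g (Sup K) - g (Inf K))"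
        using C' by (intro mult_right_mono) auto
      finally show "norm (f (Sup K) - f (Inf K)) \<le> C' * norm (g (Sup K) - g (Inf K))" .
    qed
    also have "\<dots> = C' * (\<Sum>K\<in>D. norm (g (Sup K) - g (Inf K)))"
      by (simp add: sum_distrib_left)
    also have "\<dots> < C' * (e / C')"
      using *[OF D] C' by (intro mult_strict_left_mono) auto
    finally show ?thesis using C' by simp
  qed
  ultimately show "\<exists>d>0. \<forall>D T. D division_of T \<and> T \<subseteq> S \<and> (\<Sum>K\<in>D. Sup K - Inf K) < d
        \<longrightarrow> (\<Sum>K\<in>D. norm (f (Sup K) - f (Inf K))) < e"
    by blast
qed

lemma abs_continuous_on_id: "abs_continuous_on S (\<lambda>x. x)"
  unfolding abs_continuous_on_def
proof (intro allI impI)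
  fix e :: real assume "e > 0"
  moreover have "(\<Sum>K\<in>D. norm (Sup K - Inf K)) < e"
    if "D division_of T \<and> T \<subseteq> S \<and> (\<Sum>K\<in>D. Sup K - Inf K) < e" for D T
    using that division_of_real_interval(1)[of D T] by auto
  ultimately show "\<exists>d>0. \<forall>D T. D division_of T \<and> T \<subseteq> S \<and> (\<Sum>K\<in>D. Sup K - Inf K) < d
        \<longrightarrow> (\<Sum>K\<in>D. norm (Sup K - Inf K)) < e"
    by blast
qed

lemma abs_continuous_on_add:
  assumes "abs_continuous_on S f" "abs_continuous_on S g"
  shows "abs_continuous_on S (\<lambda>x. f x + g x)"
  unfolding abs_continuous_on_def
proof (intro allI impI)
  fix e :: real assume "e > 0"
  then have "e / 2 > 0" by simp
  from assms(1)[unfolded abs_continuous_on_def, rule_format, OF this] obtain d1 where d1: "d1 > 0"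
    "\<And>D T. D division_of T \<and> T \<subseteq> S \<and> (\<Sum>K\<in>D. Sup K - Inf K) < d1
        \<Longrightarrow> (\<Sum>K\<in>D. norm (f (Sup K) - f (Inf K))) < e / 2"
    by metis
  from assms(2)[unfolded abs_continuous_on_def, rule_format, OF \<open>e / 2 > 0\<close>] obtain d2 where d2: "d2 > 0"
    "\<And>D T. D division_of T \<and> T \<subseteq> S \<and> (\<Sum>K\<in>D. Sup K - Inf K) < d2
        \<Longrightarrow> (\<Sum>K\<in>D. norm (g (Sup K) - g (Inf K))) < e / 2"
    by metis
  have "(\<Sum>K\<in>D. norm (f (Sup K) + g (Sup K) - (f (Inf K) + g (Inf K)))) < e"
    if "D division_of T \<and> T \<subseteq> S \<and> (\<Sum>K\<in>D. Sup K - Inf K) < min d1 d2" for D T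
  proof -
    have "(\<Sum>K\<in>D. norm (f (Sup K) + g (Sup K) - (f (Inf K) + g (Inf K))))
      \<le> (\<Sum>K\<in>D. norm (f (Sup K) - f (Inf K)) + norm (g (Sup K) - g (Inf K)))"
      by (intro sum_mono norm_diff_triangle_ineq)
    also have "\<dots> < e / 2 + e / 2"
      unfolding sum.distrib using that by (intro add_strict_mono d1(2) d2(2)) auto
    finally show ?thesis by simp
  qed
  moreover have "min d1 d2 > 0" using d1 d2 by simp
  ultimately show "\<exists>d>0. \<forall>D T. D division_of T \<and> T \<subseteq> S \<and> (\<Sum>K\<in>D. Sup K - Inf K) < d
        \<longrightarrow> (\<Sum>K\<in>D. norm (f (Sup K) + g (Sup K) - (f (Inf K) + g (Inf K)))) < e"
    by blast
qed

lemma abs_continuous_on_diff: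
  assumes f: "abs_continuous_on S f" and g: "abs_continuous_on S g"
  shows "abs_continuous_on S (\<lambda>x. f x - g x)"
proof -
  have "abs_continuous_on S (\<lambda>x. - g x)"
    by (rule abs_continuous_on_dominated[OF g, where C = 1]) (simp add: norm_minus_commute)
  from abs_continuous_on_add[OF f this] show ?thesis by simp
qed

text \<open>
  The intervals between the values of a monotone \<open>\<gamma>\<close> at the end points of nonoverlapping intervals
  are again nonoverlapping, and their total length is controlled by the absolute continuity of \<open>\<gamma>\<close>.
\<close>

lemma abs_continuous_on_compose_mono:
  fixes \<gamma> :: "real \<Rightarrow> real"
  assumes f: "abs_continuous_on {a..b} f" and g: "abs_continuous_on S \<gamma>"
    and mono: "mono_on S \<gamma>" and maps: "\<gamma> \<in> S \<rightarrow> {a..b}"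
  shows "abs_continuous_on S (\<lambda>x. f (\<gamma> x))"
  unfolding abs_continuous_on_def
proof (intro allI impI)
  fix e :: real assume "e > 0"
  from abs_continuous_on_nonoverlapping[OF f this] obtain d where d: "d > 0" and
    *: "\<And>J a' b'. \<lbrakk>nonoverlapping_in {a..b} (J::real set set) a' b'; (\<Sum>j\<in>J. b' j - a' j) < d\<rbrakk>
      \<Longrightarrow> (\<Sum>j\<in>J. norm (f (b' j) - f (a' j))) < e"
    by metis
  from g[unfolded abs_continuous_on_def, rule_format, OF d] obtain d' where d': "d' > 0" and
    **: "\<And>D T. D division_of T \<and> T \<subseteq> S \<and> (\<Sum>K\<in>D. Sup K - Inf K) < d'
        \<Longrightarrow> (\<Sum>K\<in>D. norm (\<gamma> (Sup K) - \<gamma> (Inf K))) < d"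
    by metis
  have "(\<Sum>K\<in>D. norm (f (\<gamma> (Sup K)) - f (\<gamma> (Inf K)))) < e"
    if D: "D division_of T \<and> T \<subseteq> S \<and> (\<Sum>K\<in>D. Sup K - Inf K) < d'" for D T
  proof (rule *, rule nonoverlapping_inI)
    have K: "Inf K \<le> Sup K" "Inf K \<in> S" "Sup K \<in> S" if "K \<in> D" for K
      using division_of_real_interval(1,4,5)[of D T K] D that by auto
    have le: "\<gamma> (Inf K) \<le> \<gamma> (Sup K)" if "K \<in> D" for K
      using K[OF that] mono by (auto simp: mono_on_def)
    then show "\<gamma> (Inf K) \<le> \<gamma> (Sup K)" if "K \<in> D" for K using that .
    show "finite D" using D by auto
    show "{\<gamma> (Inf K)..\<gamma> (Sup K)} \<subseteq> {a..b}" if "K \<in> D" for K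
      using K[OF that] maps by (fastforce simp: Pi_iff)
    show "\<gamma> (Sup K) \<le> \<gamma> (Inf L) \<or> \<gamma> (Sup L) \<le> \<gamma> (Inf K)"
      if KL: "K \<in> D" "L \<in> D" "K \<noteq> L" and lt: "\<gamma> (Inf K) < \<gamma> (Sup K)" "\<gamma> (Inf L) < \<gamma> (Sup L)" for K L
    proof -
      have "Inf K < Sup K" "Inf L < Sup L"
        using K(1)[of K] K(1)[of L] KL lt by (auto simp: less_le)
      then have "Sup K \<le> Inf L \<or> Sup L \<le> Inf K"
        using division_of_real_ordered[of D T K L] D KL by auto
      then show ?thesis
        using mono K KL by (auto simp: mono_on_def)
    qed
    have "(\<Sum>K\<in>D. \<gamma> (Sup K) - \<gamma> (Inf K)) = (\<Sum>K\<in>D. norm (\<gamma> (Sup K) - \<gamma> (Inf K)))"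
      using le by (intro sum.cong) auto
    then show "(\<Sum>K\<in>D. \<gamma> (Sup K) - \<gamma> (Inf K)) < d"
      using **[OF D] by simp
  qed
  with d' show "\<exists>d>0. \<forall>D T. D division_of T \<and> T \<subseteq> S \<and> (\<Sum>K\<in>D. Sup K - Inf K) < d
        \<longrightarrow> (\<Sum>K\<in>D. norm (f (\<gamma> (Sup K)) - f (\<gamma> (Inf K)))) < e"
    by blast
qed

lemma abs_continuous_on_imp_continuous_on:
  fixes f :: "real \<Rightarrow> 'a::real_normed_vector"
  assumes f: "abs_continuous_on {a..b} f"
  shows "continuous_on {a..b} f"
  unfolding continuous_on_iff
proof (intro ballI allI impI)
  fix x and e :: real assume x: "x \<in> {a..b}" and "e > 0"
  from f[unfolded abs_continuous_on_def, rule_format, OF this(2)] obtain d where d: "d > 0" and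
    *: "\<And>D T. D division_of T \<and> T \<subseteq> {a..b} \<and> (\<Sum>K\<in>D. Sup K - Inf K) < d
        \<Longrightarrow> (\<Sum>K\<in>D. norm (f (Sup K) - f (Inf K))) < e"
    by metis
  have **: "norm (f t - f s) < e" if "s \<le> t" "s \<in> {a..b}" "t \<in> {a..b}" "t - s < d" for s t
  proof -
    have "{{s..t}} division_of {s..t}"
      using division_of_self[of s t] that by (simp add: box_real)
    then show ?thesis
      using *[of "{{s..t}}" "{s..t}"] that by auto
  qed
  have "dist (f y) (f x) < e" if "y \<in> {a..b}" "dist y x < d" for y
    using **[of x y] **[of y x] that x by (cases "x \<le> y") (auto simp: dist_norm norm_minus_commute)
  with d show "\<exists>d>0. \<forall>y\<in>{a..b}. dist y x < d \<longrightarrow> dist (f y) (f x) < e" by blast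
qed

section \<open>Total variation\<close>

text \<open>
  Variation is taken over monotone sequences rather than over divisions: clamping a sequence at a point
  splits it into two sequences of the same length, and composing it with a monotone function gives another one.
\<close>

definition chain_sums :: "(real \<Rightarrow> 'a::real_normed_vector) \<Rightarrow> real \<Rightarrow> real \<Rightarrow> real set" where
  "chain_sums f a b =
    {\<Sum>i<n. norm (f (x (Suc i)) - f (x i)) | x (n::nat). mono x \<and> (\<forall>i. x i \<in> {a..b})}"

definition total_variation :: "(real \<Rightarrow> 'a::real_normed_vector) \<Rightarrow> real \<Rightarrow> real \<Rightarrow> real" where
  "total_variation f a b = Sup (chain_sums f a b)"

lemma chain_sumsE:
  assumes "v \<in> chain_sums f a b"
  obtains x and n :: nat where "mono x" "\<And>i. x i \<in> {a..b}"
    "v = (\<Sum>i<n. norm (f (x (Suc i)) - f (x i)))"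
  using assms unfolding chain_sums_def mem_Collect_eq by metis

lemma chain_sums_mono:
  assumes "a' \<le> a" "b \<le> b'"
  shows "chain_sums f a b \<subseteq> chain_sums f a' b'"
proof
  fix v assume "v \<in> chain_sums f a b"
  from chain_sumsE[OF this] obtain x and n :: nat where "mono x" "\<And>i. x i \<in> {a..b}"
    "v = (\<Sum>i<n. norm (f (x (Suc i)) - f (x i)))"
    by metis
  moreover have "\<forall>i. x i \<in> {a'..b'}"
    using calculation(2) assms by (meson atLeastAtMost_iff order.trans)
  ultimately show "v \<in> chain_sums f a' b'"
    unfolding chain_sums_def by blast
qed

lemma chain_sums_nonempty: "a \<le> b \<Longrightarrow> chain_sums f a b \<noteq> {}"
  by (auto simp: chain_sums_def intro!: exI[of _ "\<lambda>_. a"] monoI)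

text \<open>
  The two chains are \<open>min (x i) t\<close> and \<open>max (x i) t\<close>.  Only the step that crosses \<open>t\<close> is divided, and there
  the triangle inequality applies.
\<close>

lemma chain_sums_split:
  assumes v: "v \<in> chain_sums f a b" and t: "t \<in> {a..b}"
  obtains v1 v2 where "v1 \<in> chain_sums f a t" "v2 \<in> chain_sums f t b" "v \<le> v1 + v2"
proof -
  obtain x and n :: nat where x: "mono x" "\<And>i. x i \<in> {a..b}"
    and v_eq: "v = (\<Sum>i<n. norm (f (x (Suc i)) - f (x i)))"
    using chain_sumsE[OF v] by metis
  define y z where "y = (\<lambda>i. min (x i) t)" and "z = (\<lambda>i. max (x i) t)"
  have "mono y" "mono z"
    using x(1) by (fastforce simp: y_def z_def mono_def min_def max_def)+
  moreover have "\<forall>i. y i \<in> {a..t}" "\<forall>i. z i \<in> {t..b}"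
    using x(2) t by (auto simp: y_def z_def)
  ultimately have "(\<Sum>i<n. norm (f (y (Suc i)) - f (y i))) \<in> chain_sums f a t"
    "(\<Sum>i<n. norm (f (z (Suc i)) - f (z i))) \<in> chain_sums f t b"
    by (auto simp: chain_sums_def)
  moreover have "v \<le> (\<Sum>i<n. norm (f (y (Suc i)) - f (y i))) + (\<Sum>i<n. norm (f (z (Suc i)) - f (z i)))"
    unfolding v_eq sum.distrib[symmetric]
  proof (rule sum_mono)
    fix i
    have le: "x i \<le> x (Suc i)" using x(1) by (simp add: mono_def)
    consider "x (Suc i) \<le> t" | "t \<le> x i" | "x i < t" "t < x (Suc i)" by linarith
    then show "norm (f (x (Suc i)) - f (x i))
        \<le> norm (f (y (Suc i)) - f (y i)) + norm (f (z (Suc i)) - f (z i))"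
    proof cases
      case 3
      then show ?thesis
        using norm_triangle_ineq[of "f (x (Suc i)) - f t" "f t - f (x i)"]
        by (simp add: y_def z_def)
    qed (use le in \<open>simp_all add: y_def z_def\<close>)
  qed
  ultimately show thesis using that by blast
qed

lemma chain_sum_le:
  fixes x :: "nat \<Rightarrow> real"
  assumes "mono x" "\<And>i. x i \<in> {a..b}"
  shows "(\<Sum>i<n. x (Suc i) - x i) \<le> b - a"
proof -
  show ?thesis using assms(2)[of n] assms(2)[of 0] by (simp add: sum_lessThan_telescope)
qed

lemma mono_chain_ordered:
  fixes x :: "nat \<Rightarrow> real"
  assumes "mono x" "i \<noteq> j"
  shows "x (Suc i) \<le> x j \<or> x (Suc j) \<le> x i"
  using assms by (metis Suc_leI linorder_neqE_nat monoD)

text \<open>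
  The interval is cut into \<open>N\<close> pieces shorter than the \<open>\<delta>\<close> that belongs to \<open>\<epsilon> = 1\<close>; each piece
  contributes at most \<open>1\<close> to the variation.
\<close>

lemma abs_continuous_on_bdd_above_chain_sums:
  assumes f: "abs_continuous_on I01 f"
  shows "bdd_above (chain_sums f 0 1)"
proof -
  obtain d where d: "d > 0" and
    *: "\<And>J a' b'. \<lbrakk>nonoverlapping_in I01 (J::nat set) a' b'; (\<Sum>j\<in>J. b' j - a' j) < d\<rbrakk>
      \<Longrightarrow> (\<Sum>j\<in>J. norm (f (b' j) - f (a' j))) < 1"
    using abs_continuous_on_nonoverlapping[OF f zero_less_one] by metis
  have short: "v \<le> 1" if v: "v \<in> chain_sums f s t" and st: "0 \<le> s" "t \<le> 1" "t - s < d" for v s t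
  proof -
    obtain x and n :: nat where x: "mono x" "\<And>i. x i \<in> {s..t}"
      and v_eq: "v = (\<Sum>i<n. norm (f (x (Suc i)) - f (x i)))"
      using chain_sumsE[OF v] by metis
    have "v < 1" unfolding v_eq
    proof (rule *, rule nonoverlapping_inI)
      show "{x i..x (Suc i)} \<subseteq> I01" for i
        using st x(2)[of i] x(2)[of "Suc i"] by auto
      show "x (Suc i) \<le> x j \<or> x (Suc j) \<le> x i" if "i \<noteq> j" for i j
        using mono_chain_ordered[OF x(1) that] .
      show "(\<Sum>i<n. x (Suc i) - x i) < d"
        using chain_sum_le[OF x] st(3) by (rule order.strict_trans1)
      show "x i \<le> x (Suc i)" for i using x(1) by (simp add: mono_def)
    qed auto
    then show ?thesis by simp
  qed
  obtain N :: nat where N: "N > 0" "1 / real N < d"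
    using d by (metis nat_approx_posE zero_less_Suc)
  have "v \<le> real k" if "v \<in> chain_sums f 0 t" "0 \<le> t" "t \<le> 1" "t \<le> real k / N" for k v t
    using that
  proof (induction k arbitrary: v t)
    case 0
    then have "t = 0" by simp
    have "v = 0" using 0 unfolding \<open>t = 0\<close> chain_sums_def
      by (auto simp: image_subset_iff intro!: sum.neutral)
    then show ?case by simp
  next
    case (Suc k)
    define s where "s = min t (k / N)"
    have "s \<in> {0..t}" using Suc.prems by (auto simp: s_def)
    from chain_sums_split[OF Suc.prems(1) this]
    obtain v1 v2 where v: "v1 \<in> chain_sums f 0 s" "v2 \<in> chain_sums f s t" "v \<le> v1 + v2"
      by blast
    have "v1 \<le> k"
      using Suc.IH[OF v(1)] Suc.prems by (auto simp: s_def)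
    moreover have "t - s \<le> 1 / N"
      using Suc.prems N by (auto simp: s_def min_def field_simps)
    then have "v2 \<le> 1"
      using short[OF v(2)] Suc.prems N \<open>s \<in> {0..t}\<close> by auto
    ultimately show ?case using v(3) by simp
  qed
  from this[of _ 1 N] show ?thesis
    using N by (auto intro!: bdd_aboveI[of _ "real N"])
qed

text \<open>
  A chain that ends below \<open>s\<close> can be prolonged by the step from \<open>s\<close> to \<open>t\<close>.
\<close>

lemma total_variation_dominates:
  assumes bdd: "bdd_above (chain_sums f a b)" and st: "a \<le> s" "s \<le> t" "t \<le> b"
  shows "total_variation f a s + norm (f t - f s) \<le> total_variation f a t"
proof -
  have bdd_t: "bdd_above (chain_sums f a t)"
    using bdd chain_sums_mono[of a a t b f] st by (metis bdd_above_mono order_refl)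
  have "total_variation f a s \<le> total_variation f a t - norm (f t - f s)"
    unfolding total_variation_def
  proof (rule cSup_least)
    show "chain_sums f a s \<noteq> {}" using st by (simp add: chain_sums_nonempty)
    fix v assume "v \<in> chain_sums f a s"
    from chain_sumsE[OF this] obtain x and n :: nat where x: "mono x" "\<And>i. x i \<in> {a..s}"
      and v_eq: "v = (\<Sum>i<n. norm (f (x (Suc i)) - f (x i)))"
      by metis
    have xs: "a \<le> x i" "x i \<le> s" for i using x(2)[of i] by auto
    define y where "y = (\<lambda>i. if i \<le> n then x i else if i = Suc n then s else t)"
    have "x i \<le> t" for i using xs(2)[of i] st by simp
    then have "mono y"
      using x(1) xs st by (auto simp: y_def mono_def)
    moreover have "\<forall>i. y i \<in> {a..t}"
      using xs st by (auto simp: y_def intro: order.trans)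
    ultimately have "(\<Sum>i<Suc (Suc n). norm (f (y (Suc i)) - f (y i))) \<in> chain_sums f a t"
      unfolding chain_sums_def by blast
    then have "(\<Sum>i<Suc (Suc n). norm (f (y (Suc i)) - f (y i))) \<le> Sup (chain_sums f a t)"
      using bdd_t by (rule cSup_upper)
    moreover have "(\<Sum>i<n. norm (f (y (Suc i)) - f (y i))) = v"
      unfolding v_eq by (intro sum.cong) (auto simp: y_def)
    moreover have "y (Suc (Suc n)) = t" "y (Suc n) = s" by (auto simp: y_def)
    ultimately show "v \<le> Sup (chain_sums f a t) - norm (f t - f s)"
      by (simp add: algebra_simps) (smt (verit) norm_ge_zero)
  qed
  then show ?thesis by simp
qed

lemma total_variation_subadditive:
  assumes bdd: "bdd_above (chain_sums f a b)" and st: "a \<le> s" "s \<le> t" "t \<le> b"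
  shows "total_variation f a t \<le> total_variation f a s + total_variation f s t"
  unfolding total_variation_def
proof (rule cSup_least)
  show "chain_sums f a t \<noteq> {}" using st by (simp add: chain_sums_nonempty)
  fix v assume v: "v \<in> chain_sums f a t"
  obtain v1 v2 where "v1 \<in> chain_sums f a s" "v2 \<in> chain_sums f s t" "v \<le> v1 + v2"
    using chain_sums_split[OF v] st by auto
  moreover have "bdd_above (chain_sums f a s)" "bdd_above (chain_sums f s t)"
    using bdd chain_sums_mono[of a a s b f] chain_sums_mono[of a s t b f] st
    by (metis bdd_above_mono order_refl order.trans)+
  ultimately show "v \<le> Sup (chain_sums f a s) + Sup (chain_sums f s t)"
    by (meson add_mono cSup_upper order.trans)
qed

text \<open>
  By subadditivity the increment of the variation over an interval is at most the variation on that interval,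
  which is approximated by a chain inside it.  All these chains together form one nonoverlapping family of the
  same total length, to which the absolute continuity of \<open>f\<close> applies.
\<close>

lemma abs_continuous_on_total_variation:
  assumes f: "abs_continuous_on I01 f"
  shows "abs_continuous_on I01 (total_variation f 0)"
  unfolding abs_continuous_on_def
proof (intro allI impI)
  fix e :: real assume e: "e > 0"
  note bdd = abs_continuous_on_bdd_above_chain_sums[OF f]
  from e have "e / 2 > 0" by simp
  from abs_continuous_on_nonoverlapping[OF f this] obtain d where d: "d > 0" and
    *: "\<And>J a' b'. \<lbrakk>nonoverlapping_in I01 (J::(real set \<times> nat) set) a' b'; (\<Sum>j\<in>J. b' j - a' j) < d\<rbrakk>
      \<Longrightarrow> (\<Sum>j\<in>J. norm (f (b' j) - f (a' j))) < e / 2"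
    by metis
  have "(\<Sum>K\<in>D. norm (total_variation f 0 (Sup K) - total_variation f 0 (Inf K))) < e"
    if "D division_of T \<and> T \<subseteq> I01 \<and> (\<Sum>K\<in>D. Sup K - Inf K) < d" for D T
  proof -
    have D: "D division_of T" "T \<subseteq> I01" "(\<Sum>K\<in>D. Sup K - Inf K) < d" "finite D"
      using that by auto
    have K: "Inf K \<le> Sup K" "0 \<le> Inf K" "Sup K \<le> 1" if "K \<in> D" for K
      using division_of_real_interval(1,4,5)[OF D(1) that] D(2) by auto
    \<comment> \<open>The error allowed for each interval; adding \<open>1\<close> avoids a division by zero when \<open>D\<close> is empty.\<close>
    define \<eta> where "\<eta> = e / (2 * (real (card D) + 1))"
    have \<eta>: "\<eta> > 0" using e by (simp add: \<eta>_def)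
    have "\<exists>p. mono (fst p) \<and> (\<forall>i. fst p i \<in> {Inf K..Sup K}) \<and> total_variation f (Inf K) (Sup K) - \<eta>
        < (\<Sum>i<snd p. norm (f (fst p (Suc i)) - f (fst p i)))"
      if KD: "K \<in> D" for K
    proof -
      have "bdd_above (chain_sums f (Inf K) (Sup K))"
        by (rule bdd_above_mono[OF bdd]) (intro chain_sums_mono K[OF KD])
      moreover have "total_variation f (Inf K) (Sup K) - \<eta> < Sup (chain_sums f (Inf K) (Sup K))"
        using \<eta> by (simp add: total_variation_def)
      ultimately obtain v where v: "v \<in> chain_sums f (Inf K) (Sup K)" "total_variation f (Inf K) (Sup K) - \<eta> < v"
        using less_cSup_iff[OF chain_sums_nonempty[OF K(1)[OF KD], of f]] by blast
      obtain x and n :: nat where "mono x" "\<And>i. x i \<in> {Inf K..Sup K}"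
        "v = (\<Sum>i<n. norm (f (x (Suc i)) - f (x i)))"
        using chain_sumsE[OF v(1)] by metis
      with v(2) show ?thesis by (intro exI[of _ "(x, n)"]) simp
    qed
    then have "\<exists>p. \<forall>K\<in>D. mono (fst (p K)) \<and> (\<forall>i. fst (p K) i \<in> {Inf K..Sup K}) \<and>
        total_variation f (Inf K) (Sup K) - \<eta>
        < (\<Sum>i<snd (p K). norm (f (fst (p K) (Suc i)) - f (fst (p K) i)))"
      by (intro bchoice ballI)
    then obtain p where p: "\<forall>K\<in>D. mono (fst (p K)) \<and> (\<forall>i. fst (p K) i \<in> {Inf K..Sup K}) \<and>
        total_variation f (Inf K) (Sup K) - \<eta>
        < (\<Sum>i<snd (p K). norm (f (fst (p K) (Suc i)) - f (fst (p K) i)))" ..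
    define x and n :: "real set \<Rightarrow> nat" where "x = (\<lambda>K. fst (p K))" and "n = (\<lambda>K. snd (p K))"
    have mono: "\<And>K. K \<in> D \<Longrightarrow> mono (x K)" and range: "\<And>K i. K \<in> D \<Longrightarrow> x K i \<in> {Inf K..Sup K}"
      and approx: "\<And>K. K \<in> D \<Longrightarrow> total_variation f (Inf K) (Sup K) - \<eta>
        < (\<Sum>i<n K. norm (f (x K (Suc i)) - f (x K i)))"
      using p by (simp_all add: x_def n_def)
    have xK: "Inf K \<le> x K i" "x K i \<le> Sup K" if "K \<in> D" for K i
      using range[OF that, of i] by auto
    define J where "J = (SIGMA K:D. {..<n K})"
    have "(\<Sum>(K, i)\<in>J. norm (f (x K (Suc i)) - f (x K i))) < e / 2"
      unfolding case_prod_beta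
    proof (rule *, rule nonoverlapping_inI)
      show "finite J" using D by (auto simp: J_def)
      show "x (fst j) (snd j) \<le> x (fst j) (Suc (snd j))" if "j \<in> J" for j
        using mono that by (auto simp: J_def mono_def)
      show "{x (fst j) (snd j)..x (fst j) (Suc (snd j))} \<subseteq> I01" if "j \<in> J" for j
      proof -
        have j: "fst j \<in> D" using that by (auto simp: J_def)
        show ?thesis
          using xK[OF j, of "snd j"] xK[OF j, of "Suc (snd j)"] K[OF j] by auto
      qed
      show "x (fst i) (Suc (snd i)) \<le> x (fst j) (snd j) \<or> x (fst j) (Suc (snd j)) \<le> x (fst i) (snd i)"
        if ij: "i \<in> J" "j \<in> J" "i \<noteq> j"
          and lt: "x (fst i) (snd i) < x (fst i) (Suc (snd i))" "x (fst j) (snd j) < x (fst j) (Suc (snd j))"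
        for i j
      proof (cases "fst i = fst j")
        case True
        then have "snd i \<noteq> snd j" using ij by (metis prod_eqI)
        moreover have "fst i \<in> D" using ij by (auto simp: J_def)
        ultimately show ?thesis
          using mono_chain_ordered[OF mono, of "fst i" "snd i" "snd j"] True by simp
      next
        case False
        have D': "fst i \<in> D" "fst j \<in> D" using ij by (auto simp: J_def)
        note xi = xK[OF D'(1), of "snd i"] xK[OF D'(1), of "Suc (snd i)"]
          xK[OF D'(2), of "snd j"] xK[OF D'(2), of "Suc (snd j)"]
        have "Inf (fst i) < Sup (fst i)" "Inf (fst j) < Sup (fst j)"
          using xi lt by linarith+
        then have "Sup (fst i) \<le> Inf (fst j) \<or> Sup (fst j) \<le> Inf (fst i)"
          using division_of_real_ordered[OF D(1) D' False] by simp
        then show ?thesis using xi by linarith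
      qed
      have "(\<Sum>j\<in>J. x (fst j) (Suc (snd j)) - x (fst j) (snd j))
          = (\<Sum>K\<in>D. \<Sum>i<n K. x K (Suc i) - x K i)"
        unfolding J_def using D by (subst sum.Sigma) (auto simp: case_prod_beta)
      also have "\<dots> \<le> (\<Sum>K\<in>D. Sup K - Inf K)"
        by (intro sum_mono chain_sum_le mono range)
      finally show "(\<Sum>j\<in>J. x (fst j) (Suc (snd j)) - x (fst j) (snd j)) < d"
        using D by simp
    qed
    then have half: "(\<Sum>K\<in>D. \<Sum>i<n K. norm (f (x K (Suc i)) - f (x K i))) < e / 2"
      unfolding J_def using D by (subst sum.Sigma) auto
    have "(\<Sum>K\<in>D. norm (total_variation f 0 (Sup K) - total_variation f 0 (Inf K)))
        \<le> (\<Sum>K\<in>D. (\<Sum>i<n K. norm (f (x K (Suc i)) - f (x K i))) + \<eta>)"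
    proof (rule sum_mono)
      fix K assume "K \<in> D"
      note K' = K[OF this]
      have "total_variation f 0 (Inf K) \<le> total_variation f 0 (Sup K)"
        using total_variation_dominates[OF bdd, of "Inf K" "Sup K"] K'
        by (smt (verit) norm_ge_zero)
      then show "norm (total_variation f 0 (Sup K) - total_variation f 0 (Inf K))
          \<le> (\<Sum>i<n K. norm (f (x K (Suc i)) - f (x K i))) + \<eta>"
        using total_variation_subadditive[OF bdd, of "Inf K" "Sup K"] K' approx[OF \<open>K \<in> D\<close>]
        by simp
    qed
    also have "\<dots> = (\<Sum>K\<in>D. \<Sum>i<n K. norm (f (x K (Suc i)) - f (x K i))) + card D * \<eta>"
      by (simp add: sum.distrib)
    also have "\<dots> < e / 2 + e / 2"
    proof (rule add_less_le_mono[OF half])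
      show "card D * \<eta> \<le> e / 2"
        using e by (simp add: \<eta>_def field_simps)
    qed
    finally show ?thesis by simp
  qed
  with d show "\<exists>d>0. \<forall>D T. D division_of T \<and> T \<subseteq> I01 \<and> (\<Sum>K\<in>D. Sup K - Inf K) < d
        \<longrightarrow> (\<Sum>K\<in>D. norm (total_variation f 0 (Sup K) - total_variation f 0 (Inf K))) < e"
    by blast
qed

section \<open>Lebesgue's fundamental theorem of calculus\<close>

text \<open>
  A bounded null set is covered by countably many nonoverlapping intervals of small total length.
  Finitely many of them carry Stieltjes measure below \<open>\<epsilon>\<close> by the absolute continuity of \<open>F\<close>, and
  monotone convergence extends the bound to the whole cover.
\<close>

lemma stieltjes_absolutely_continuous:
  fixes F :: "real \<Rightarrow> real"
  assumes mono: "mono F" and ac: "abs_continuous_on UNIV F" and cont: "continuous_on UNIV F"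
  shows "absolutely_continuous lborel (interval_measure F)"
  unfolding absolutely_continuous_def
proof
  fix N :: "real set" assume N: "N \<in> null_sets lborel"
  let ?\<mu> = "interval_measure F"
  have Icc: "emeasure ?\<mu> {a..b} = ennreal (F b - F a)" if "a \<le> b" for a b
    using emeasure_interval_measure_Icc[OF that _ cont] mono by (simp add: mono_def)
  have null: "emeasure ?\<mu> S = 0" if S: "S \<in> null_sets lborel" "S \<subseteq> cbox a b" for S a b
  proof -
    have "emeasure ?\<mu> S \<le> ennreal e" if "e > 0" for e
    proof -
      from ac[unfolded abs_continuous_on_def, rule_format, OF that] obtain d where d: "d > 0"
        "\<And>D T. D division_of T \<and> T \<subseteq> UNIV \<and> (\<Sum>K\<in>D. Sup K - Inf K) < d
            \<Longrightarrow> (\<Sum>K\<in>D. norm (F (Sup K) - F (Inf K))) < e"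
        by metis
      have neg: "negligible S"
        using S(1) by (simp add: negligible_iff_null_sets null_sets_completionI)
      then have lm: "S \<in> lmeasurable" "measure lebesgue S = 0"
        by (simp_all add: negligible_iff_measure)
      obtain \<D> where \<D>: "countable \<D>"
        "\<And>K. K \<in> \<D> \<Longrightarrow> K \<subseteq> cbox a b \<and> K \<noteq> {} \<and> (\<exists>c d. K = cbox c d)"
        "pairwise (\<lambda>A B. interior A \<inter> interior B = {}) \<D>"
        "S \<subseteq> \<Union>\<D>" "\<Union>\<D> \<in> lmeasurable" "measure lebesgue (\<Union>\<D>) \<le> measure lebesgue S + d / 2"
        using measurable_outer_intervals_bounded[OF lm(1) S(2), of "d / 2"] d(1) by (metis half_gt_zero)
      have sets: "K \<in> sets borel" if "K \<in> \<D>" for K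
        using \<D>(2)[OF that] by auto
      have fin: "emeasure ?\<mu> (\<Union>E) \<le> ennreal e" if E: "finite E" "E \<subseteq> \<D>" for E
      proof -
        have div: "E division_of \<Union>E"
        proof (rule division_ofI)
          show "\<And>K1 K2. K1 \<in> E \<Longrightarrow> K2 \<in> E \<Longrightarrow> K1 \<noteq> K2 \<Longrightarrow> interior K1 \<inter> interior K2 = {}"
            using \<D>(3) E(2) unfolding pairwise_def by blast
        qed (use \<D>(2) E in auto)
        note K = division_of_real_interval[OF div]
        have "(\<Sum>K\<in>E. Sup K - Inf K) = (\<Sum>K\<in>E. measure lebesgue K)"
        proof (rule sum.cong)
          fix x assume x: "x \<in> E"
          have "measure lebesgue {Inf x..Sup x} = Sup x - Inf x" using K(1)[OF x] by simp
          then show "Sup x - Inf x = measure lebesgue x" using K(2)[OF x] by simp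
        qed simp
        also have "\<dots> = measure lebesgue (\<Union>E)"
          using content_division[OF div] by simp
        also have "\<dots> \<le> measure lebesgue (\<Union>\<D>)"
        proof (rule measure_mono_fmeasurable)
          show "\<Union>E \<in> sets lebesgue"
            using E sets by (intro sets.finite_Union) (auto intro: sets_completionI_sets)
        qed (use E \<D>(5) in auto)
        also have "\<dots> < d" using \<D>(6) lm d(1) by simp
        finally have "(\<Sum>K\<in>E. norm (F (Sup K) - F (Inf K))) < e"
          using div by (intro d(2)) auto
        moreover have "emeasure ?\<mu> (\<Union>E) \<le> (\<Sum>K\<in>E. emeasure ?\<mu> K)"
          using emeasure_subadditive_finite[of E "\<lambda>K. K" ?\<mu>] E sets by auto
        moreover have "(\<Sum>K\<in>E. emeasure ?\<mu> K) = (\<Sum>K\<in>E. ennreal (norm (F (Sup K) - F (Inf K))))"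
        proof (rule sum.cong)
          fix x assume x: "x \<in> E"
          have "emeasure ?\<mu> {Inf x..Sup x} = ennreal (norm (F (Sup x) - F (Inf x)))"
            using Icc[OF K(1)[OF x]] monoD[OF mono K(1)[OF x]] by simp
          then show "emeasure ?\<mu> x = ennreal (norm (F (Sup x) - F (Inf x)))"
            using K(2)[OF x] by simp
        qed simp
        ultimately show ?thesis
          using that by (simp add: sum_ennreal) (meson ennreal_leI less_imp_le order.trans)
      qed
      show ?thesis
      proof (cases "\<D> = {}")
        case True
        then have "S = {}" using \<D>(4) by simp
        then show ?thesis by simp
      next
        case False
        define A where "A n = \<Union>(from_nat_into \<D> ` {..n})" for n
        have in\<D>: "from_nat_into \<D> n \<in> \<D>" for n
          using False by (rule from_nat_into)
        have A: "range A \<subseteq> sets ?\<mu>"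
          using sets in\<D> by (auto simp: A_def)
        have "incseq A"
          unfolding A_def incseq_def by (intro allI impI Union_mono image_mono) auto
        have "emeasure ?\<mu> S \<le> emeasure ?\<mu> (\<Union>n. A n)"
        proof (rule emeasure_mono)
          have "\<Union>(range (from_nat_into \<D>)) \<subseteq> (\<Union>n. A n)"
            by (auto simp: A_def)
          then show "S \<subseteq> (\<Union>n. A n)"
            using \<D>(4) range_from_nat_into[OF False \<D>(1)] by simp
        qed (use A in auto)
        also have "\<dots> = (SUP n. emeasure ?\<mu> (A n))"
          using SUP_emeasure_incseq[OF A \<open>incseq A\<close>] by simp
        also have "\<dots> \<le> ennreal e"
        proof (rule SUP_least)
          fix n show "emeasure ?\<mu> (A n) \<le> ennreal e"
            unfolding A_def by (rule fin) (use in\<D> in auto)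
        qed
        finally show ?thesis .
      qed
    qed
    then show ?thesis
      using ennreal_le_epsilon[of 0 "emeasure ?\<mu> S"] by simp
  qed
  have "N = (\<Union>k::nat. N \<inter> cbox (- real k) (real k))"
  proof -
    have "\<exists>k::nat. - real k \<le> x \<and> x \<le> real k" for x :: real
      using real_arch_simple[of "\<bar>x\<bar>"] by (metis abs_le_iff minus_le_iff)
    then show ?thesis by auto
  qed
  moreover have "(\<Union>k::nat. N \<inter> cbox (- real k) (real k)) \<in> null_sets ?\<mu>"
  proof (rule null_sets_UN)
    fix k :: nat
    have S: "N \<inter> cbox (- real k) (real k) \<in> null_sets lborel"
      using N by (rule null_set_Int2) simp
    then show "N \<inter> cbox (- real k) (real k) \<in> null_sets ?\<mu>"
      using null[OF S] by (auto simp: null_sets_def)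
  qed
  ultimately show "N \<in> null_sets ?\<mu>" by simp
qed

text \<open>
  The function is extended to the line by constants.  The density of its Stieltjes measure takes values in the
  extended half-line; it has finite integral over the unit interval, so it is finite there almost everywhere.
\<close>

lemma mono_abs_continuous_on_density:
  fixes M :: "real \<Rightarrow> real"
  assumes ac: "abs_continuous_on I01 M" and mono: "mono_on I01 M"
  obtains g where "integrable lborel g" "\<And>x. x \<in> I01 \<Longrightarrow> (g has_integral (M x - M 0)) {0..x}"
proof -
  define F where "F x = M (max 0 (min 1 x))" for x
  have F: "mono F"
    using mono unfolding F_def by (auto simp: mono_on_def mono_def)
  have clamp: "abs_continuous_on UNIV (\<lambda>x::real. max 0 (min 1 x))"
    by (rule abs_continuous_on_dominated[OF abs_continuous_on_id, where C = 1]) auto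
  have acF: "abs_continuous_on UNIV F"
    unfolding F_def
    by (rule abs_continuous_on_compose_mono[OF ac clamp]) (auto simp: mono_on_def)
  have "continuous_on UNIV F"
    unfolding F_def
    by (rule continuous_on_compose2[OF abs_continuous_on_imp_continuous_on[OF ac]])
      (auto intro!: continuous_intros)
  note cont = this
  have "absolutely_continuous lborel (interval_measure F)"
    by (rule stieltjes_absolutely_continuous[OF F acF cont])
  then obtain f where f[measurable]: "f \<in> borel_measurable lborel"
    and dens: "density lborel f = interval_measure F"
    using sigma_finite_measure.Radon_Nikodym[OF sigma_finite_lborel, of "interval_measure F"] by auto
  have nn: "(\<integral>\<^sup>+t. f t * indicator {0..x} t \<partial>lborel) = ennreal (M x - M 0)" if "x \<in> I01" for x
  proof -
    have "(\<integral>\<^sup>+t. f t * indicator {0..x} t \<partial>lborel) = emeasure (interval_measure F) {0..x}"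
      unfolding dens[symmetric] by (simp add: emeasure_density)
    also have "\<dots> = ennreal (F x - F 0)"
      using emeasure_interval_measure_Icc[of 0 x F] that cont F by (simp add: mono_def)
    also have "F x - F 0 = M x - M 0"
    proof -
      have "max 0 (min 1 x) = x" using that by simp
      then show ?thesis by (simp add: F_def)
    qed
    finally show ?thesis .
  qed
  have "AE t in lborel. f t * indicator I01 t \<noteq> \<infinity>"
    by (rule nn_integral_PInf_AE) (auto simp: nn[of 1])
  note finite = this
  define g where "g t = enn2real (f t * indicator I01 t)" for t
  have g[measurable]: "g \<in> borel_measurable lborel" unfolding g_def by simp
  have g0: "g t \<ge> 0" for t by (simp add: g_def)
  have gx: "(\<integral>\<^sup>+t. ennreal (g t * indicator {0..x} t) \<partial>lborel) = ennreal (M x - M 0)" if "x \<in> I01" for x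
    unfolding nn[OF that, symmetric]
  proof (rule nn_integral_cong_AE)
    show "AE t in lborel. ennreal (g t * indicator {0..x} t) = f t * indicator {0..x} t"
      using finite
    proof eventually_elim
      case (elim t)
      then show ?case
        using that by (auto simp: g_def indicator_def less_top)
    qed
  qed
  show thesis
  proof (rule that[of g])
    have ind: "g t * indicator {0..1} t = g t" for t by (simp add: g_def indicator_def)
    have "(\<integral>\<^sup>+t. ennreal (g t) \<partial>lborel) = (\<integral>\<^sup>+t. ennreal (g t * indicator {0..1} t) \<partial>lborel)"
      by (simp only: ind)
    also have "\<dots> = ennreal (M 1 - M 0)"
      by (rule gx) simp
    finally have "(\<integral>\<^sup>+t. ennreal (g t) \<partial>lborel) = ennreal (M 1 - M 0)" .
    then show "integrable lborel g"
      using g0 by (intro integrableI_nn_integral_finite[where x = "M 1 - M 0"])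
        (use mono in \<open>auto simp: mono_on_def\<close>)
    show "(g has_integral (M x - M 0)) {0..x}" if x: "x \<in> I01" for x
    proof -
      have "((\<lambda>t. g t * indicator {0..x} t) has_integral (M x - M 0)) UNIV"
        by (rule nn_integral_has_integral[OF _ _ gx[OF x]])
          (use g0 x mono in \<open>auto simp: mono_on_def\<close>)
      moreover have "(\<lambda>t. g t * indicator {0..x} t) = (\<lambda>t. if t \<in> {0..x} then g t else 0)"
        by (auto simp: fun_eq_iff)
      ultimately show ?thesis by (simp only: has_integral_restrict_UNIV)
    qed
  qed
qed

text \<open>
  The averages of an integrable function over \<open>[x, x + h]\<close> converge to its value for almost every \<open>x\<close>.
  This is used for \<open>g\<close> and for its reflection, which gives the derivative from the right and from the left.
\<close>

lemma integral_has_vector_derivative_ae: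
  fixes g :: "real \<Rightarrow> 'a::euclidean_space"
  assumes g: "\<And>a b. g integrable_on {a..b}"
  obtains N where "negligible N"
    "\<And>x. \<lbrakk>x \<in> {a..b}; x \<notin> N\<rbrakk> \<Longrightarrow> ((\<lambda>t. integral {a..t} g) has_vector_derivative g x) (at x within {a..b})"
proof -
  obtain N1 where N1: "negligible N1" "\<And>x e. \<lbrakk>x \<notin> N1; 0 < e\<rbrakk> \<Longrightarrow>
      \<exists>d>0. \<forall>h. 0 < h \<and> h < d \<longrightarrow> norm (integral {x..x + h} g /\<^sub>R h - g x) < e"
    using integrable_ccontinuous_explicit[of g] g by auto
  have "(\<lambda>x. g (- x)) integrable_on {a..b}" for a b
    using Henstock_Kurzweil_Integration.integrable_reflect_real[where f = g and a = "- b" and b = "- a"] g by simp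
  then obtain N2 where N2: "negligible N2" "\<And>x e. \<lbrakk>x \<notin> N2; 0 < e\<rbrakk> \<Longrightarrow>
      \<exists>d>0. \<forall>h. 0 < h \<and> h < d \<longrightarrow> norm (integral {x..x + h} (\<lambda>x. g (- x)) /\<^sub>R h - g (- x)) < e"
    using integrable_ccontinuous_explicit[of "\<lambda>x. g (- x)"] by auto
  have scale: "norm (v - h *\<^sub>R w) \<le> e * h" if "0 < h" "norm (v /\<^sub>R h - w) < e" for v w :: 'a and h e :: real
  proof -
    have "v - h *\<^sub>R w = h *\<^sub>R (v /\<^sub>R h - w)" using that by (simp add: algebra_simps)
    then have "norm (v - h *\<^sub>R w) = h * norm (v /\<^sub>R h - w)" using that by simp
    also have "\<dots> \<le> h * e" using that by (intro mult_left_mono) auto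
    finally show ?thesis by (simp add: mult.commute)
  qed
  show thesis
  proof (rule that[of "N1 \<union> uminus ` N2"])
    show "negligible (N1 \<union> uminus ` N2)"
      using N1(1) N2(1)
      by (intro negligible_Un negligible_differentiable_image_negligible)
        (auto intro!: derivative_intros simp: differentiable_on_def)
    fix x assume x: "x \<in> {a..b}" "x \<notin> N1 \<union> uminus ` N2"
    then have x1: "x \<notin> N1" and x2: "- x \<notin> N2" by (auto simp: image_iff)
    show "((\<lambda>t. integral {a..t} g) has_vector_derivative g x) (at x within {a..b})"
      unfolding has_vector_derivative_def has_derivative_within_alt
    proof (intro conjI allI impI bounded_linear_scaleR_left)
      fix e :: real assume "e > 0"
      obtain d1 where d1: "d1 > 0" "\<And>h. 0 < h \<Longrightarrow> h < d1 \<Longrightarrow> norm (integral {x..x + h} g /\<^sub>R h - g x) < e"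
        using N1(2)[OF x1 \<open>e > 0\<close>] by blast
      obtain d2 where d2: "d2 > 0" "\<And>h. 0 < h \<Longrightarrow> h < d2 \<Longrightarrow>
          norm (integral {- x..- x + h} (\<lambda>x. g (- x)) /\<^sub>R h - g x) < e"
        using N2(2)[OF x2 \<open>e > 0\<close>] by auto
      have "norm (integral {a..y} g - integral {a..x} g - (y - x) *\<^sub>R g x) \<le> e * norm (y - x)"
        if y: "y \<in> {a..b}" "norm (y - x) < min d1 d2" for y
      proof -
        consider "y = x" | "x < y" | "y < x" by linarith
        then show ?thesis
        proof cases
          case 2
          have "integral {a..y} g = integral {a..x} g + integral {x..y} g"
            using Henstock_Kurzweil_Integration.integral_combine[of a x y g] g x 2 by auto
          moreover have "norm (integral {x..y} g - (y - x) *\<^sub>R g x) \<le> e * (y - x)"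
            using scale[OF _ d1(2)[of "y - x"]] 2 y by auto
          ultimately show ?thesis using 2 by simp
        next
          case 3
          have "integral {a..x} g = integral {a..y} g + integral {y..x} g"
            using Henstock_Kurzweil_Integration.integral_combine[of a y x g] g y 3 by auto
          moreover have "integral {- x..- x + (x - y)} (\<lambda>x. g (- x)) = integral {y..x} g"
            using Henstock_Kurzweil_Integration.integral_reflect_real[of x y g] by simp
          then have "norm (integral {y..x} g - (x - y) *\<^sub>R g x) \<le> e * (x - y)"
            using scale[OF _ d2(2)[of "x - y"]] 3 y by auto
          then have "norm (- (integral {y..x} g - (x - y) *\<^sub>R g x)) \<le> e * (x - y)"
            by (simp only: norm_minus_cancel)
          ultimately show ?thesis using 3 by (simp add: algebra_simps)
        qed simp
      qed
      then show "\<exists>d>0. \<forall>y\<in>{a..b}. norm (y - x) < d \<longrightarrow>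
          norm (integral {a..y} g - integral {a..x} g - (y - x) *\<^sub>R g x) \<le> e * norm (y - x)"
        using d1 d2 by (intro exI[of _ "min d1 d2"]) auto
    qed
  qed
qed

text \<open>
  For each coordinate \<open>c \<bullet> b = (V + c \<bullet> b) - V\<close> is a difference of monotone absolutely continuous
  functions, where \<open>V\<close> is the variation of the whole curve.
\<close>

lemma abs_continuous_on_density:
  fixes c :: "real \<Rightarrow> 'a::euclidean_space"
  assumes ac: "abs_continuous_on I01 c"
  obtains g where "integrable lborel g" "\<And>x. x \<in> I01 \<Longrightarrow> (g has_integral (c x - c 0)) {0..x}"
proof -
  define V where "V = total_variation c 0"
  have acV: "abs_continuous_on I01 V"
    unfolding V_def by (rule abs_continuous_on_total_variation[OF ac])
  have dom: "norm (c t - c s) \<le> V t - V s" if "0 \<le> s" "s \<le> t" "t \<le> 1" for s t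
    using total_variation_dominates[OF abs_continuous_on_bdd_above_chain_sums[OF ac] that]
    by (simp add: V_def)
  have "mono_on I01 V"
  proof (rule mono_onI)
    fix s t :: real assume "s \<in> I01" "t \<in> I01" "s \<le> t"
    then show "V s \<le> V t" using order.trans[OF norm_ge_zero dom[of s t]] by auto
  qed
  then obtain g0 where g0: "integrable lborel g0" "\<And>x. x \<in> I01 \<Longrightarrow> (g0 has_integral (V x - V 0)) {0..x}"
    using mono_abs_continuous_on_density[OF acV] by metis
  have "\<exists>g. integrable lborel g \<and> (\<forall>x\<in>I01. (g has_integral (V x + c x \<bullet> b - (V 0 + c 0 \<bullet> b))) {0..x})"
    if b: "b \<in> Basis" for b
  proof -
    have comp: "\<bar>c t \<bullet> b - c s \<bullet> b\<bar> \<le> norm (c t - c s)" for s t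
      using Basis_le_norm[OF b, of "c t - c s"] by (simp add: inner_diff_left)
    have "abs_continuous_on I01 (\<lambda>x. c x \<bullet> b)"
      by (rule abs_continuous_on_dominated[OF ac, where C = 1]) (use comp in simp)
    then have ac': "abs_continuous_on I01 (\<lambda>x. V x + c x \<bullet> b)"
      by (rule abs_continuous_on_add[OF acV])
    have "mono_on I01 (\<lambda>x. V x + c x \<bullet> b)"
    proof (rule mono_onI)
      fix s t :: real assume "s \<in> I01" "t \<in> I01" "s \<le> t"
      then show "V s + c s \<bullet> b \<le> V t + c t \<bullet> b"
        using dom[of s t] comp[of t s] by (simp add: abs_le_iff)
    qed
    then obtain h where "integrable lborel h"
      "\<And>x. x \<in> I01 \<Longrightarrow> (h has_integral (V x + c x \<bullet> b - (V 0 + c 0 \<bullet> b))) {0..x}"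
      using mono_abs_continuous_on_density[OF ac'] by metis
    then show ?thesis by blast
  qed
  then obtain g where g: "\<And>b. b \<in> Basis \<Longrightarrow> integrable lborel (g b)"
    "\<And>b x. b \<in> Basis \<Longrightarrow> x \<in> I01 \<Longrightarrow> (g b has_integral (V x + c x \<bullet> b - (V 0 + c 0 \<bullet> b))) {0..x}"
    by metis
  show thesis
  proof (rule that)
    show "integrable lborel (\<lambda>t. \<Sum>b\<in>Basis. (g b t - g0 t) *\<^sub>R b)"
      using g(1) g0(1) by (intro Bochner_Integration.integrable_sum integrable_scaleR_left
          Bochner_Integration.integrable_diff) auto
    fix x :: real assume x: "x \<in> I01"
    have "((\<lambda>t. \<Sum>b\<in>Basis. (g b t - g0 t) *\<^sub>R b) has_integral
      (\<Sum>b\<in>Basis. ((V x + c x \<bullet> b - (V 0 + c 0 \<bullet> b)) - (V x - V 0)) *\<^sub>R b)) {0..x}"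
      by (intro has_integral_sum has_integral_scaleR_left has_integral_diff g(2) g0(2) x) auto
    moreover have "(\<Sum>b\<in>Basis. ((V x + c x \<bullet> b - (V 0 + c 0 \<bullet> b)) - (V x - V 0)) *\<^sub>R b)
        = (\<Sum>b\<in>Basis. ((c x - c 0) \<bullet> b) *\<^sub>R b)"
      by (intro sum.cong) (auto simp: inner_diff_left)
    ultimately show "((\<lambda>t. \<Sum>b\<in>Basis. (g b t - g0 t) *\<^sub>R b) has_integral (c x - c 0)) {0..x}"
      by (simp add: euclidean_representation)
  qed
qed

abbreviation D01 :: "(real \<Rightarrow> 'a::real_normed_vector) \<Rightarrow> real \<Rightarrow> 'a" where
  "D01 c t \<equiv> vector_derivative c (at t within I01)"

lemma D01_eq: "\<lbrakk>(c has_vector_derivative c') (at t within I01); t \<in> I01\<rbrakk> \<Longrightarrow> D01 c t = c'"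
  for c :: "real \<Rightarrow> 'a::euclidean_space"
  using vector_derivative_within_closed_interval[of 0 1 t c c'] by simp

lemma AE_lebesgue_on_I01_negligible:
  assumes "negligible N" "\<And>t. \<lbrakk>t \<in> I01; t \<notin> N\<rbrakk> \<Longrightarrow> P t"
  shows "AE t in lebesgue_on I01. P t"
proof -
  have "AE t in lebesgue. t \<notin> N"
    using assms(1) by (intro AE_not_in) (simp add: negligible_iff_null_sets)
  then show ?thesis
    using assms(2) by (subst AE_restrict_space_iff) (auto elim: eventually_mono)
qed

theorem abs_continuous_on_fundamental:
  fixes c :: "real \<Rightarrow> 'a::euclidean_space"
  assumes ac: "abs_continuous_on I01 c"
  shows "AE t in lebesgue_on I01. (c has_vector_derivative D01 c t) (at t within I01)"
    and "integrable (lebesgue_on I01) (D01 c)"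
    and "\<And>s t. \<lbrakk>0 \<le> s; s \<le> t; t \<le> 1\<rbrakk> \<Longrightarrow> (D01 c has_integral (c t - c s)) {s..t}"
proof -
  obtain g where g: "integrable lborel g" "\<And>x. x \<in> I01 \<Longrightarrow> (g has_integral (c x - c 0)) {0..x}"
    using abs_continuous_on_density[OF ac] by metis
  have int: "g integrable_on {a..b}" for a b
    using integrable_on_lborel[OF g(1)] integrable_on_subinterval by blast
  obtain N where N: "negligible N" "\<And>x. \<lbrakk>x \<in> I01; x \<notin> N\<rbrakk> \<Longrightarrow>
      ((\<lambda>t. integral {0..t} g) has_vector_derivative g x) (at x within I01)"
    using integral_has_vector_derivative_ae[of g 0 1] int by metis
  have deriv: "(c has_vector_derivative g x) (at x within I01)" if x: "x \<in> I01" "x \<notin> N" for x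
  proof (rule has_vector_derivative_transform[OF x(1)])
    show "((\<lambda>t. c 0 + integral {0..t} g) has_vector_derivative g x) (at x within I01)"
      using has_vector_derivative_add[OF has_vector_derivative_const N(2)[OF x], of "c 0"] by simp
    show "c t = c 0 + integral {0..t} g" if "t \<in> I01" for t
      using g(2)[OF that] by (simp add: integral_unique)
  qed
  have D: "D01 c t = g t" if "t \<in> I01" "t \<notin> N" for t
    using D01_eq[OF deriv[OF that] that(1)] .
  show "AE t in lebesgue_on I01. (c has_vector_derivative D01 c t) (at t within I01)"
    by (rule AE_lebesgue_on_I01_negligible[OF N(1)]) (use deriv D in simp)
  have "integrable lebesgue g"
    using g(1) borel_measurable_integrable[OF g(1)] by (simp add: integrable_completion)
  then have "g absolutely_integrable_on I01"
    unfolding set_integrable_def by (intro integrable_mult_indicator) simp_all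
  then have "(D01 c) absolutely_integrable_on I01"
    by (rule absolutely_integrable_spike[OF _ N(1)]) (use D in simp)
  then show "integrable (lebesgue_on I01) (D01 c)"
    by (rule absolutely_integrable_imp_integrable) simp
  fix s t :: real assume st: "0 \<le> s" "s \<le> t" "t \<le> 1"
  have "(g has_integral (integral {s..t} g)) {s..t}"
    using int by (rule integrable_integral)
  moreover have "integral {s..t} g = c t - c s"
    using Henstock_Kurzweil_Integration.integral_combine[of 0 s t g] int st
      integral_unique[OF g(2)[of s]] integral_unique[OF g(2)[of t]] by (auto simp: algebra_simps)
  ultimately have "(g has_integral (c t - c s)) {s..t}" by simp
  then show "(D01 c has_integral (c t - c s)) {s..t}"
    by (rule has_integral_spike[OF N(1), rotated]) (use D st in simp)
qed

lemma at_within_I01_nontrivial: "t \<in> I01 \<Longrightarrow> at t within I01 \<noteq> bot"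
  using islimpt_Icc[of 0 1 t] by (simp add: trivial_limit_within)

section \<open>The norm is the total variation\<close>

text \<open>
  The difference quotients of \<open>f\<close> at \<open>t\<close> are bounded by those of \<open>V\<close>, on both sides of \<open>t\<close>; the factor
  \<open>sgn (y - t)\<close> covers the two sides at once.
\<close>

lemma norm_vector_derivative_le:
  fixes V :: "real \<Rightarrow> real"
  assumes f: "(f has_vector_derivative f') (at t within S)" and V: "(V has_vector_derivative v) (at t within S)"
    and nontriv: "at t within S \<noteq> bot"
    and le: "\<And>y. y \<in> S \<Longrightarrow> norm (f y - f t) \<le> (V y - V t) * sgn (y - t)"
  shows "norm f' \<le> v"
proof (rule field_le_epsilon)
  fix e :: real assume "e > 0"
  then have e: "e / 2 > 0" by simp
  have "\<forall>\<^sub>F y in at t within S. norm (f y - f t - (y - t) *\<^sub>R f') \<le> e / 2 * norm (y - t)"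
    "\<forall>\<^sub>F y in at t within S. norm (V y - V t - (y - t) *\<^sub>R v) \<le> e / 2 * norm (y - t)"
    using f V e unfolding has_vector_derivative_def has_derivative_within_alt2 by blast+
  moreover have "\<forall>\<^sub>F y in at t within S. y \<in> S \<and> y \<noteq> t"
    by (simp add: eventually_at_filter)
  ultimately have "\<forall>\<^sub>F y in at t within S. norm (f y - f t - (y - t) *\<^sub>R f') \<le> e / 2 * norm (y - t) \<and>
      norm (V y - V t - (y - t) *\<^sub>R v) \<le> e / 2 * norm (y - t) \<and> y \<in> S \<and> y \<noteq> t"
    by eventually_elim simp
  then obtain y where y: "norm (f y - f t - (y - t) *\<^sub>R f') \<le> e / 2 * norm (y - t)"
    "norm (V y - V t - (y - t) *\<^sub>R v) \<le> e / 2 * norm (y - t)" "y \<in> S" "y \<noteq> t"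
    using eventually_happens'[OF nontriv] by blast
  define h where "h = \<bar>y - t\<bar>"
  have h: "h > 0" using y by (simp add: h_def)
  have "h * norm f' = norm ((y - t) *\<^sub>R f')"
    by (simp add: h_def)
  also have "\<dots> \<le> norm (f y - f t) + norm (f y - f t - (y - t) *\<^sub>R f')"
    using norm_triangle_ineq4[of "f y - f t" "f y - f t - (y - t) *\<^sub>R f'"] by simp
  also have "\<dots> \<le> (V y - V t) * sgn (y - t) + e / 2 * h"
    using le[OF y(3)] y(1) by (simp add: h_def)
  also have "(V y - V t) * sgn (y - t) \<le> h * v + e / 2 * h"
  proof -
    have "V y - V t - (y - t) * v \<le> e / 2 * h" "- (V y - V t - (y - t) * v) \<le> e / 2 * h"
      using y(2) abs_le_D1 abs_le_D2 by (simp_all only: h_def real_norm_def real_scaleR_def)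
    moreover have "(V y - V t) * sgn (y - t) = - (V y - V t) \<and> h * v = - ((y - t) * v) \<or>
        (V y - V t) * sgn (y - t) = V y - V t \<and> h * v = (y - t) * v"
      using y(4) by (cases "y < t") (auto simp: h_def algebra_simps)
    ultimately show ?thesis by linarith
  qed
  finally have "h * norm f' \<le> h * (v + e)"
    by (simp add: algebra_simps)
  then show "norm f' \<le> v + e" using h by simp
qed

lemma total_variation_nonneg:
  assumes bdd: "bdd_above (chain_sums f a b)" and "a \<le> b"
  shows "0 \<le> total_variation f a b"
proof -
  have "0 \<in> chain_sums f a b"
    unfolding chain_sums_def mem_Collect_eq
    by (rule exI[of _ "\<lambda>_. a"], rule exI[of _ 0]) (use assms in \<open>simp add: mono_def\<close>)
  then show ?thesis
    unfolding total_variation_def using bdd by (rule cSup_upper)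
qed

lemma AC_norm_eq_integral:
  fixes c :: "real \<Rightarrow> 'a::euclidean_space"
  assumes ac: "abs_continuous_on I01 c" and f: "integrable (lebesgue_on I01) f"
    and deriv: "AE t in lebesgue_on I01. (c has_vector_derivative f t) (at t within I01)"
  shows "AC_norm c = (\<integral>t. norm (f t) \<partial>lebesgue_on I01)"
  unfolding AC_norm_def
proof (rule integral_cong_AE)
  show "(\<lambda>t. norm (D01 c t)) \<in> borel_measurable (lebesgue_on I01)"
    using abs_continuous_on_fundamental(2)[OF ac] by auto
  show "(\<lambda>t. norm (f t)) \<in> borel_measurable (lebesgue_on I01)"
    using f by auto
  show "AE t in lebesgue_on I01. norm (D01 c t) = norm (f t)"
    using deriv AE_space
  proof eventually_elim
    case (elim t)
    then show ?case using D01_eq[of c "f t" t] by simp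
  qed
qed

text \<open>
  The variation function \<open>V\<close> dominates the increments of \<open>c\<close>, so \<open>|c'| \<le> V'\<close> almost everywhere, and the
  integral of \<open>V'\<close> is the increment of \<open>V\<close>.  Conversely each increment of \<open>c\<close> is at most the integral of \<open>|c'|\<close> over
  the same interval.
\<close>

theorem AC_norm_eq_total_variation:
  fixes c :: "real \<Rightarrow> 'a::euclidean_space"
  assumes ac: "abs_continuous_on I01 c"
  shows "AC_norm c = total_variation c 0 1"
proof (rule order.antisym)
  define V where "V = total_variation c 0"
  note fund = abs_continuous_on_fundamental[OF ac]
  note bdd = abs_continuous_on_bdd_above_chain_sums[OF ac]
  have acV: "abs_continuous_on I01 V"
    unfolding V_def by (rule abs_continuous_on_total_variation[OF ac])
  note fundV = abs_continuous_on_fundamental[OF acV]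
  have dom: "norm (c t - c s) \<le> V t - V s" if "0 \<le> s" "s \<le> t" "t \<le> 1" for s t
    using total_variation_dominates[OF bdd that] by (simp add: V_def)
  have "AE t in lebesgue_on I01. norm (D01 c t) \<le> D01 V t"
    using fund(1) fundV(1) AE_space
  proof eventually_elim
    case (elim t)
    then have t: "t \<in> I01" by simp
    show ?case
    proof (rule norm_vector_derivative_le[OF elim(1,2) at_within_I01_nontrivial[OF t]])
      fix y :: real assume "y \<in> I01"
      then show "norm (c y - c t) \<le> (V y - V t) * sgn (y - t)"
        using dom[of t y] dom[of y t] t by (cases y t rule: linorder_cases) (auto simp: norm_minus_commute)
    qed
  qed
  then have "AC_norm c \<le> (\<integral>t. D01 V t \<partial>lebesgue_on I01)"
    unfolding AC_norm_def using fund(2) fundV(2) by (intro integral_mono_AE) auto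
  also have "\<dots> = V 1 - V 0"
    using lebesgue_integral_eq_integral[OF fundV(2)] integral_unique[OF fundV(3)[of 0 1]] by simp
  also have "\<dots> \<le> V 1"
  proof -
    have "bdd_above (chain_sums c 0 0)"
      by (rule bdd_above_mono[OF bdd]) (rule chain_sums_mono, auto)
    then show ?thesis
      using total_variation_nonneg[of c 0 0] by (simp add: V_def)
  qed
  finally show "AC_norm c \<le> total_variation c 0 1" by (simp add: V_def)
next
  note fund = abs_continuous_on_fundamental[OF ac]
  let ?n = "\<lambda>t. norm (D01 c t)"
  have I: "(?n has_integral AC_norm c) I01"
    unfolding AC_norm_def using fund(2) by (intro has_integral_integral_lebesgue_on) auto
  have int: "?n integrable_on {s..t}" if "0 \<le> s" "t \<le> 1" for s t
    using has_integral_integrable[OF I] by (rule integrable_on_subinterval) (use that in auto)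
  define M where "M t = integral {0..t} ?n" for t
  have step: "norm (c t - c s) \<le> M t - M s" if "0 \<le> s" "s \<le> t" "t \<le> 1" for s t
  proof -
    have "norm (c t - c s) \<le> integral {s..t} ?n"
      using integral_norm_bound_integral[of "D01 c" "{s..t}" ?n] fund(3)[OF that] int[of s t] that
      by (auto simp: integral_unique has_integral_integrable)
    moreover have "M s + integral {s..t} ?n = M t"
      unfolding M_def using that int[of 0 t]
      by (intro Henstock_Kurzweil_Integration.integral_combine) auto
    ultimately show ?thesis by simp
  qed
  have bounds: "0 \<le> M t" "M t \<le> AC_norm c" if "t \<in> I01" for t
  proof -
    show "0 \<le> M t"
      unfolding M_def using that int[of 0 t] by (intro integral_nonneg) auto
    have "M t \<le> M 1" using order.trans[OF norm_ge_zero step[of t 1]] that by auto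
    then show "M t \<le> AC_norm c" using integral_unique[OF I] by (simp add: M_def)
  qed
  show "total_variation c 0 1 \<le> AC_norm c"
    unfolding total_variation_def
  proof (rule cSup_least)
    show "chain_sums c 0 1 \<noteq> {}" by (simp add: chain_sums_nonempty)
    fix v assume "v \<in> chain_sums c 0 1"
    from chain_sumsE[OF this] obtain x and n :: nat where x: "mono x" "\<And>i. x i \<in> I01"
      and v_eq: "v = (\<Sum>i<n. norm (c (x (Suc i)) - c (x i)))"
      by metis
    have "v \<le> (\<Sum>i<n. M (x (Suc i)) - M (x i))"
      unfolding v_eq
    proof (rule sum_mono)
      fix i show "norm (c (x (Suc i)) - c (x i)) \<le> M (x (Suc i)) - M (x i)"
        using step[of "x i" "x (Suc i)"] x(2)[of i] x(2)[of "Suc i"] monoD[OF x(1), of i "Suc i"] by simp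
    qed
    also have "\<dots> = M (x n) - M (x 0)"
      by (rule sum_lessThan_telescope)
    also have "\<dots> \<le> AC_norm c"
      using bounds[OF x(2)[of n]] bounds[OF x(2)[of 0]] by simp
    finally show "v \<le> AC_norm c" .
  qed
qed

lemma AC_norm_nonneg: "0 \<le> AC_norm c"
  unfolding AC_norm_def by (rule Bochner_Integration.integral_nonneg) simp

lemma chain_sum_le_AC_norm:
  fixes c :: "real \<Rightarrow> 'a::euclidean_space"
  assumes "abs_continuous_on I01 c" "mono x" "\<And>i. x i \<in> I01"
  shows "(\<Sum>i<n. norm (c (x (Suc i)) - c (x i))) \<le> AC_norm c"
  unfolding AC_norm_eq_total_variation[OF assms(1)] total_variation_def
  using assms abs_continuous_on_bdd_above_chain_sums[OF assms(1)]
  by (intro cSup_upper) (auto simp: chain_sums_def)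

lemma AC_norm_leI:
  fixes c :: "real \<Rightarrow> 'a::euclidean_space"
  assumes "abs_continuous_on I01 c"
    and "\<And>x n. \<lbrakk>mono x; \<And>i. x i \<in> I01\<rbrakk> \<Longrightarrow> (\<Sum>i<n. norm (c (x (Suc i)) - c (x i))) \<le> B"
  shows "AC_norm c \<le> B"
  unfolding AC_norm_eq_total_variation[OF assms(1)] total_variation_def
proof (rule cSup_least)
  show "chain_sums c 0 1 \<noteq> {}" by (simp add: chain_sums_nonempty)
  fix v assume "v \<in> chain_sums c 0 1"
  then show "v \<le> B" using assms(2) chain_sumsE by metis
qed

lemma AC_norm_mono:
  fixes f :: "real \<Rightarrow> 'a::euclidean_space" and g :: "real \<Rightarrow> 'b::euclidean_space"
  assumes f: "abs_continuous_on I01 f" and g: "abs_continuous_on I01 g"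
    and le: "\<And>s t. \<lbrakk>s \<in> I01; t \<in> I01\<rbrakk> \<Longrightarrow> norm (f t - f s) \<le> norm (g t - g s)"
  shows "AC_norm f \<le> AC_norm g"
proof (rule AC_norm_leI[OF f])
  fix x :: "nat \<Rightarrow> real" and n assume x: "mono x" "\<And>i. x i \<in> I01"
  have "(\<Sum>i<n. norm (f (x (Suc i)) - f (x i))) \<le> (\<Sum>i<n. norm (g (x (Suc i)) - g (x i)))"
    by (intro sum_mono le x)
  also have "\<dots> \<le> AC_norm g"
    by (rule chain_sum_le_AC_norm[OF g x])
  finally show "(\<Sum>i<n. norm (f (x (Suc i)) - f (x i))) \<le> AC_norm g" .
qed

lemma AC_norm_add_le:
  fixes f g :: "real \<Rightarrow> 'a::euclidean_space"
  assumes f: "abs_continuous_on I01 f" and g: "abs_continuous_on I01 g"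
  shows "AC_norm (\<lambda>t. f t + g t) \<le> AC_norm f + AC_norm g"
proof (rule AC_norm_leI[OF abs_continuous_on_add[OF f g]])
  fix x :: "nat \<Rightarrow> real" and n assume x: "mono x" "\<And>i. x i \<in> I01"
  have "(\<Sum>i<n. norm (f (x (Suc i)) + g (x (Suc i)) - (f (x i) + g (x i))))
      \<le> (\<Sum>i<n. norm (f (x (Suc i)) - f (x i)) + norm (g (x (Suc i)) - g (x i)))"
    by (intro sum_mono norm_diff_triangle_ineq)
  also have "\<dots> \<le> AC_norm f + AC_norm g"
    unfolding sum.distrib by (intro add_mono chain_sum_le_AC_norm f g x)
  finally show "(\<Sum>i<n. norm (f (x (Suc i)) + g (x (Suc i)) - (f (x i) + g (x i)))) \<le> AC_norm f + AC_norm g" .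
qed

text \<open>
  Every chain sum of \<open>c \<circ> \<gamma>\<close> is a chain sum of \<open>c\<close>.
\<close>

lemma AC_norm_compose_mono_le:
  fixes c :: "real \<Rightarrow> 'a::euclidean_space"
  assumes c: "abs_continuous_on I01 c" and \<gamma>: "abs_continuous_on I01 \<gamma>"
    and mono: "mono_on I01 \<gamma>" and maps: "\<gamma> \<in> I01 \<rightarrow> I01"
  shows "AC_norm (\<lambda>t. c (\<gamma> t)) \<le> AC_norm c"
proof (rule AC_norm_leI[OF abs_continuous_on_compose_mono[OF c \<gamma> mono maps]])
  fix x :: "nat \<Rightarrow> real" and n assume x: "mono x" "\<And>i. x i \<in> I01"
  have "mono (\<lambda>i. \<gamma> (x i))"
    using x mono by (simp add: mono_def mono_on_def)
  moreover have "\<gamma> (x i) \<in> I01" for i using x(2)[of i] maps by blast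
  ultimately show "(\<Sum>i<n. norm (c (\<gamma> (x (Suc i))) - c (\<gamma> (x i)))) \<le> AC_norm c"
    by (rule chain_sum_le_AC_norm[OF c])
qed

lemma norm_diff_le_AC_norm:
  fixes c :: "real \<Rightarrow> 'a::euclidean_space"
  assumes c: "abs_continuous_on I01 c" and t: "t \<in> I01"
  shows "norm (c t - c 0) \<le> AC_norm c"
  using chain_sum_le_AC_norm[OF c, of "\<lambda>i. if i = 0 then 0 else t" 1] t by (auto simp: mono_def)

text \<open>
  A metric space in the sense of \<^locale>\<open>Metric_space\<close> has a distance that is symmetric on the whole type.  This holds
  even for curves without derivatives: where one difference is not differentiable neither is the other,
  and both derivatives have the same default value.
\<close>

lemma AC_dist_commute: "AC_dist c e = AC_dist e c" for c e :: "real \<Rightarrow> 'a::euclidean_space"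
  unfolding AC_dist_def AC_norm_def
proof (rule Bochner_Integration.integral_cong[OF refl])
  fix t assume "t \<in> space (lebesgue_on I01)"
  then have t: "t \<in> I01" by simp
  have iff: "((\<lambda>t. e t - c t) has_vector_derivative - d) (at t within I01) \<longleftrightarrow>
      ((\<lambda>t. c t - e t) has_vector_derivative d) (at t within I01)" for d
    using has_vector_derivative_minus[of "\<lambda>t. e t - c t" "- d" "at t within I01"]
      has_vector_derivative_minus[of "\<lambda>t. c t - e t" d "at t within I01"] by auto
  show "norm (D01 (\<lambda>t. c t - e t) t) = norm (D01 (\<lambda>t. e t - c t) t)"
  proof (cases "\<exists>d. ((\<lambda>t. c t - e t) has_vector_derivative d) (at t within I01)")
    case True
    then obtain d where d: "((\<lambda>t. c t - e t) has_vector_derivative d) (at t within I01)" ..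
    then show ?thesis
      using D01_eq[OF d t] D01_eq[OF iff[THEN iffD2, OF d] t] by simp
  next
    case False
    then have "\<not> ((\<lambda>t. e t - c t) has_vector_derivative d) (at t within I01)" for d
      using iff[of "- d"] by auto
    then show ?thesis using False by (simp add: vector_derivative_def)
  qed
qed

lemma AC_norm_triangle:
  fixes f g h :: "real \<Rightarrow> 'a::euclidean_space"
  assumes "abs_continuous_on I01 f" "abs_continuous_on I01 g" "abs_continuous_on I01 h"
  shows "AC_norm (\<lambda>t. f t - h t) \<le> AC_norm (\<lambda>t. f t - g t) + AC_norm (\<lambda>t. g t - h t)"
  using AC_norm_add_le[of "\<lambda>t. f t - g t" "\<lambda>t. g t - h t"] assms
  by (simp add: abs_continuous_on_diff)

lemma Metric_space_AC0: "Metric_space (AC0 :: (real \<Rightarrow> 'a::euclidean_space) set) AC_dist"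
proof
  fix c e :: "real \<Rightarrow> 'a"
  show "0 \<le> AC_dist c e" by (simp add: AC_dist_def AC_norm_nonneg)
next
  fix c e :: "real \<Rightarrow> 'a"
  show "AC_dist c e = AC_dist e c"
    by (rule AC_dist_commute)
next
  fix c e :: "real \<Rightarrow> 'a" assume ce: "c \<in> AC0" "e \<in> AC0"
  then have ac: "abs_continuous_on I01 c" "abs_continuous_on I01 e" by (auto simp: AC0_def)
  show "AC_dist c e = 0 \<longleftrightarrow> c = e"
  proof
    assume 0: "AC_dist c e = 0"
    show "c = e"
    proof (rule extensionalityI)
      show "c \<in> extensional I01" "e \<in> extensional I01" using ce by (auto simp: AC0_def)
      fix t :: real assume "t \<in> I01"
      then show "c t = e t"
        using norm_diff_le_AC_norm[OF abs_continuous_on_diff[OF ac], of t] 0 ce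
        by (simp add: AC_dist_def AC0_def)
    qed
  next
    assume "c = e"
    have "AC_norm (\<lambda>t. c t - e t) \<le> 0"
      by (rule AC_norm_leI[OF abs_continuous_on_diff[OF ac]]) (simp add: \<open>c = e\<close>)
    then show "AC_dist c e = 0"
      using AC_norm_nonneg[of "\<lambda>t. c t - e t"] by (simp add: AC_dist_def)
  qed
next
  fix c e g :: "real \<Rightarrow> 'a" assume "c \<in> AC0" "e \<in> AC0" "g \<in> AC0"
  then show "AC_dist c g \<le> AC_dist c e + AC_dist e g"
    unfolding AC_dist_def by (intro AC_norm_triangle) (auto simp: AC0_def)
qed

section \<open>Smooth curves are dense\<close>

text \<open>
  The radial retraction onto the ball of radius \<open>k\<close>.
\<close>

definition clip :: "real \<Rightarrow> 'a::real_normed_vector \<Rightarrow> 'a" where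
  "clip k v = (k / max k (norm v)) *\<^sub>R v"

lemma clip:
  assumes "k > 0"
  shows "norm (clip k v) \<le> k" "norm (clip k v) \<le> norm v" "norm v \<le> k \<Longrightarrow> clip k v = v"
    "continuous_on S (clip k)"
proof -
  have n: "norm (clip k v) = k / max k (norm v) * norm v"
    using assms by (simp add: clip_def)
  show "norm (clip k v) \<le> k" "norm (clip k v) \<le> norm v" "norm v \<le> k \<Longrightarrow> clip k v = v"
    unfolding n using assms by (auto simp: clip_def max_def divide_simps)
  show "continuous_on S (clip k)"
    unfolding clip_def using assms by (intro continuous_intros) auto
qed

text \<open>
  Two applications of dominated convergence: \<open>f\<close> is the \<open>L\<^sup>1\<close> limit of its clippings, and a fixed clipping of
  \<open>f\<close> is the limit of the clippings of continuous functions that converge to \<open>f\<close> almost everywhere.  Clipping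
  supplies the constant bound needed in the second step.
\<close>

lemma integrable_approx_continuous:
  fixes f :: "'b::euclidean_space \<Rightarrow> 'a::euclidean_space"
  assumes S: "S \<in> lmeasurable" and f: "integrable (lebesgue_on S) f" and e: "e > 0"
  obtains g where "continuous_on UNIV g" "integrable (lebesgue_on S) g"
    "(\<integral>t. norm (f t - g t) \<partial>lebesgue_on S) < e"
proof -
  let ?M = "lebesgue_on S"
  have Ss: "S \<in> sets lebesgue" using S by (rule fmeasurableD)
  interpret finite_measure ?M
    using S by (rule finite_measure_lebesgue_on)
  have clip_measurable: "(\<lambda>t. clip k (h t)) \<in> borel_measurable ?M"
    if "k > 0" "h \<in> borel_measurable ?M" for k and h :: "'b \<Rightarrow> 'a"
    using measurable_compose[OF that(2) borel_measurable_continuous_onI[OF clip(4)[OF that(1)]]] .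
  have fm: "f \<in> borel_measurable ?M" using f by auto
  have "(\<lambda>k. \<integral>t. norm (f t - clip (real (Suc k)) (f t)) \<partial>?M) \<longlonglongrightarrow> (\<integral>t. 0 \<partial>?M)"
  proof (rule integral_dominated_convergence)
    show "integrable ?M (\<lambda>t. 2 * norm (f t))" using f by auto
    show "AE t in ?M. (\<lambda>k. norm (f t - clip (real (Suc k)) (f t))) \<longlonglongrightarrow> 0"
    proof (intro AE_I2 tendsto_eventually)
      fix t
      obtain K :: nat where K: "norm (f t) \<le> real K" using real_arch_simple by blast
      show "\<forall>\<^sub>F k in sequentially. norm (f t - clip (real (Suc k)) (f t)) = 0"
        using eventually_ge_at_top[of K]
        by eventually_elim (use K in \<open>simp add: clip(3)\<close>)
    qed
    show "AE t in ?M. norm (norm (f t - clip (real (Suc k)) (f t))) \<le> 2 * norm (f t)" for k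
    proof (intro AE_I2)
      fix t
      show "norm (norm (f t - clip (real (Suc k)) (f t))) \<le> 2 * norm (f t)"
        using norm_triangle_ineq4[of "f t" "clip (real (Suc k)) (f t)"] clip(2)[of "real (Suc k)" "f t"]
        by simp
    qed
    show "(\<lambda>t. norm (f t - clip (real (Suc k)) (f t))) \<in> borel_measurable ?M" for k
      by (intro measurable_compose[OF _ borel_measurable_norm] borel_measurable_diff fm clip_measurable) auto
  qed simp_all
  then have "\<forall>\<^sub>F k in sequentially. (\<integral>t. norm (f t - clip (real (Suc k)) (f t)) \<partial>?M) < e / 2"
    using e by (intro order_tendstoD(2)[where a = "e / 2"]) auto
  then obtain k' where "(\<integral>t. norm (f t - clip (real (Suc k')) (f t)) \<partial>?M) < e / 2"
    using eventually_happens'[OF sequentially_bot] by blast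
  then obtain k where k: "k > 0" "(\<integral>t. norm (f t - clip k (f t)) \<partial>?M) < e / 2"
    using of_nat_0_less_iff zero_less_Suc by metis
  obtain N h where N: "negligible N" and h: "\<And>n::nat. continuous_on UNIV (h n)"
    and lim: "\<And>t. t \<notin> N \<Longrightarrow> (\<lambda>n. h n t) \<longlonglongrightarrow> (if t \<in> S then f t else 0)"
    using fm measurable_on_iff_borel_measurable[OF Ss, of f] unfolding measurable_on_def by blast
  have hm: "h n \<in> borel_measurable ?M" for n
    by (rule continuous_imp_measurable_on_sets_lebesgue[OF continuous_on_subset[OF h] Ss]) simp
  have "(\<lambda>n. \<integral>t. norm (clip k (f t) - clip k (h n t)) \<partial>?M) \<longlonglongrightarrow> (\<integral>t. 0 \<partial>?M)"
  proof (rule integral_dominated_convergence)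
    show "integrable ?M (\<lambda>t. 2 * k)" by simp
    have "AE t in lebesgue. t \<notin> N"
      using N by (intro AE_not_in) (simp add: negligible_iff_null_sets)
    then have "AE t in ?M. t \<notin> N \<and> t \<in> S"
      using Ss by (subst AE_restrict_space_iff) (auto elim: eventually_mono)
    then show "AE t in ?M. (\<lambda>n. norm (clip k (f t) - clip k (h n t))) \<longlonglongrightarrow> 0"
    proof eventually_elim
      case (elim t)
      then have "(\<lambda>n. h n t) \<longlonglongrightarrow> f t" using lim[of t] by simp
      then have "(\<lambda>n. clip k (h n t)) \<longlonglongrightarrow> clip k (f t)"
        using continuous_on_tendsto_compose[OF clip(4)[OF k(1), of UNIV]] by auto
      then have "(\<lambda>n. norm (clip k (f t) - clip k (h n t))) \<longlonglongrightarrow> norm (clip k (f t) - clip k (f t))"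
        by (intro tendsto_intros)
      then show ?case by simp
    qed
    show "AE t in ?M. norm (norm (clip k (f t) - clip k (h n t))) \<le> 2 * k" for n
    proof (intro AE_I2)
      fix t
      show "norm (norm (clip k (f t) - clip k (h n t))) \<le> 2 * k"
        using norm_triangle_ineq4[of "clip k (f t)" "clip k (h n t)"]
          clip(1)[OF k(1), of "f t"] clip(1)[OF k(1), of "h n t"] by simp
    qed
    show "(\<lambda>t. norm (clip k (f t) - clip k (h n t))) \<in> borel_measurable ?M" for n
      by (intro measurable_compose[OF _ borel_measurable_norm] borel_measurable_diff fm hm clip_measurable k)
  qed simp_all
  then have "\<forall>\<^sub>F n in sequentially. (\<integral>t. norm (clip k (f t) - clip k (h n t)) \<partial>?M) < e / 2"
    using e by (intro order_tendstoD(2)[where a = "e / 2"]) auto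
  then obtain n where n: "(\<integral>t. norm (clip k (f t) - clip k (h n t)) \<partial>?M) < e / 2"
    using eventually_happens'[OF sequentially_bot] by blast
  have bounded: "integrable ?M (\<lambda>t. clip k (u t))" if "u \<in> borel_measurable ?M" for u :: "'b \<Rightarrow> 'a"
    by (rule integrable_const_bound[where B = k]) (auto intro: clip(1)[OF k(1)] clip_measurable k that)
  show thesis
  proof (rule that)
    show "continuous_on UNIV (\<lambda>t. clip k (h n t))"
      by (rule continuous_on_compose2[OF clip(4)[OF k(1), of UNIV] h]) simp
    show int: "integrable ?M (\<lambda>t. clip k (h n t))" by (rule bounded[OF hm])
    note ints = f bounded[OF fm] int
    have "(\<integral>t. norm (f t - clip k (h n t)) \<partial>?M)
        \<le> (\<integral>t. norm (f t - clip k (f t)) + norm (clip k (f t) - clip k (h n t)) \<partial>?M)"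
      by (intro integral_mono Bochner_Integration.integrable_add integrable_norm
          Bochner_Integration.integrable_diff ints norm_diff_triangle_le[OF order_refl order_refl])
    also have "\<dots> = (\<integral>t. norm (f t - clip k (f t)) \<partial>?M) + (\<integral>t. norm (clip k (f t) - clip k (h n t)) \<partial>?M)"
      by (intro Bochner_Integration.integral_add integrable_norm Bochner_Integration.integrable_diff ints)
    also have "\<dots> < e" using k(2) n by simp
    finally show "(\<integral>t. norm (f t - clip k (h n t)) \<partial>?M) < e" .
  qed
qed

text \<open>
  The primitive \<open>p\<close> of a continuous \<open>L\<^sup>1\<close> approximation \<open>g\<close> of \<open>c'\<close>: the norm of \<open>c - p\<close> is the \<open>L\<^sup>1\<close>
  distance of \<open>c'\<close> and \<open>g\<close>.
\<close>

lemma AC_approx_smooth: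
  fixes c :: "real \<Rightarrow> 'a::euclidean_space"
  assumes ac: "abs_continuous_on I01 c" and e: "e > 0"
  obtains p g where "continuous_on I01 g" "\<And>x. x \<in> I01 \<Longrightarrow> (p has_vector_derivative g x) (at x within I01)"
    "abs_continuous_on I01 p" "AC_norm (\<lambda>t. c t - p t) < e"
proof -
  note fund = abs_continuous_on_fundamental[OF ac]
  obtain g where g: "continuous_on UNIV g" "integrable (lebesgue_on I01) g"
    "(\<integral>t. norm (D01 c t - g t) \<partial>lebesgue_on I01) < e"
    using integrable_approx_continuous[OF lmeasurable_interval(1) fund(2) e] by metis
  have cont: "continuous_on {s..t} g" for s t using g(1) continuous_on_subset by blast
  define p where "p x = integral {0..x} g" for x
  have deriv: "(p has_vector_derivative g x) (at x within I01)" if "x \<in> I01" for x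
    unfolding p_def using integral_has_vector_derivative[OF cont that] .
  have "bounded (g ` I01)"
    by (intro compact_imp_bounded compact_continuous_image cont) simp
  then obtain B where B: "\<And>t. t \<in> I01 \<Longrightarrow> norm (g t) \<le> B"
    unfolding bounded_iff by blast
  have acp: "abs_continuous_on I01 p"
  proof (rule abs_continuous_on_dominated[OF abs_continuous_on_id, where C = B])
    fix s t :: real assume st: "s \<le> t" "{s..t} \<subseteq> I01"
    have "p s + integral {s..t} g = p t"
      unfolding p_def using st cont
      by (intro Henstock_Kurzweil_Integration.integral_combine integrable_continuous_real) auto
    moreover have "norm (integral {s..t} g) \<le> B * (t - s)"
      using st B by (intro integral_bound cont) auto
    moreover have "norm (t - s) = t - s" using st by simp
    ultimately show "norm (p t - p s) \<le> B * norm (t - s)"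
      by (metis add_diff_cancel_left')
  qed
  have "AC_norm (\<lambda>t. c t - p t) = (\<integral>t. norm (D01 c t - g t) \<partial>lebesgue_on I01)"
  proof (rule AC_norm_eq_integral)
    show "AE t in lebesgue_on I01. ((\<lambda>t. c t - p t) has_vector_derivative D01 c t - g t) (at t within I01)"
      using fund(1) AE_space
    proof eventually_elim
      case (elim t)
      then show ?case using has_vector_derivative_diff[OF elim(1) deriv] by simp
    qed
  qed (use abs_continuous_on_diff[OF ac acp] fund(2) g(2) in auto)
  with g(3) have "AC_norm (\<lambda>t. c t - p t) < e" by simp
  with cont deriv acp that show thesis by blast
qed

section \<open>The action of the reparametrisation semigroup\<close>

lemma Gamma_barD:
  assumes "\<gamma> \<in> Gamma_bar"
  shows "abs_continuous_on I01 \<gamma>" "\<gamma> \<in> I01 \<rightarrow> I01" "\<gamma> 0 = 0" "\<gamma> 1 = 1"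
    "AE t in lebesgue_on I01. 0 \<le> D01 \<gamma> t" "\<gamma> \<in> AC0"
  using assms by (auto simp: Gamma_bar_def AC0_def PiE_def)

lemma Gamma_bar_mono:
  assumes \<gamma>: "\<gamma> \<in> Gamma_bar"
  shows "mono_on I01 \<gamma>"
proof (rule mono_onI)
  fix s t :: real assume st: "s \<in> I01" "t \<in> I01" "s \<le> t"
  note fund = abs_continuous_on_fundamental[OF Gamma_barD(1)[OF \<gamma>]]
  have AE: "AE r in lebesgue_on I01. 0 \<le> indicator {s..t} r * D01 \<gamma> r"
    using Gamma_barD(5)[OF \<gamma>] by eventually_elim simp
  have "integrable (lebesgue_on I01) (\<lambda>r. indicator {s..t} r *\<^sub>R D01 \<gamma> r)"
    using fund(2) by (rule integrable_mult_indicator[rotated]) (use st in \<open>simp add: sets_restrict_space_iff\<close>)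
  then have "((\<lambda>r. indicator {s..t} r *\<^sub>R D01 \<gamma> r) has_integral
      (\<integral>r. indicator {s..t} r *\<^sub>R D01 \<gamma> r \<partial>lebesgue_on I01)) I01"
    by (rule has_integral_integral_lebesgue_on) simp
  moreover have "((\<lambda>r. indicator {s..t} r *\<^sub>R D01 \<gamma> r) has_integral (\<gamma> t - \<gamma> s)) I01"
  proof -
    have "((\<lambda>r. if r \<in> {s..t} then D01 \<gamma> r else 0) has_integral (\<gamma> t - \<gamma> s)) I01"
      using fund(3)[of s t] st by (subst has_integral_restrict) auto
    moreover have "(\<lambda>r. if r \<in> {s..t} then D01 \<gamma> r else 0) = (\<lambda>r. indicator {s..t} r *\<^sub>R D01 \<gamma> r)"
      by (auto simp: fun_eq_iff)
    ultimately show ?thesis by simp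
  qed
  ultimately have "\<gamma> t - \<gamma> s = (\<integral>r. indicator {s..t} r *\<^sub>R D01 \<gamma> r \<partial>lebesgue_on I01)"
    by (rule has_integral_unique[rotated])
  also have "\<dots> \<ge> 0"
    using AE by (intro integral_nonneg_AE) simp
  finally show "\<gamma> s \<le> \<gamma> t" by simp
qed

lemma Gamma_bar_compose:
  fixes c :: "real \<Rightarrow> 'a::euclidean_space"
  assumes c: "abs_continuous_on I01 c" and \<gamma>: "\<gamma> \<in> Gamma_bar"
  shows "abs_continuous_on I01 (\<lambda>t. c (\<gamma> t))" "AC_norm (\<lambda>t. c (\<gamma> t)) \<le> AC_norm c"
  using abs_continuous_on_compose_mono[OF c Gamma_barD(1)[OF \<gamma>] Gamma_bar_mono[OF \<gamma>] Gamma_barD(2)[OF \<gamma>]]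
    AC_norm_compose_mono_le[OF c Gamma_barD(1)[OF \<gamma>] Gamma_bar_mono[OF \<gamma>] Gamma_barD(2)[OF \<gamma>]] .

text \<open>
  Almost everywhere \<open>(p \<circ> \<gamma>)' - (p \<circ> \<eta>)'\<close> equals
  \<open>(\<gamma>' - \<eta>') p'(\<gamma>) + \<eta>' (p'(\<gamma>) - p'(\<eta>))\<close>.  The constant \<open>\<omega>\<close> appears without a factor because
  \<open>\<eta>'\<close> is nonnegative and has integral \<open>\<eta> 1 - \<eta> 0 = 1\<close>.
\<close>

lemma AC_norm_compose_diff_le:
  fixes p :: "real \<Rightarrow> 'a::euclidean_space"
  assumes p: "abs_continuous_on I01 p"
    and deriv: "\<And>x. x \<in> I01 \<Longrightarrow> (p has_vector_derivative g x) (at x within I01)"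
    and B: "\<And>x. x \<in> I01 \<Longrightarrow> norm (g x) \<le> B"
    and \<gamma>: "\<gamma> \<in> Gamma_bar" and \<eta>: "\<eta> \<in> Gamma_bar"
    and \<omega>: "\<And>t. t \<in> I01 \<Longrightarrow> norm (g (\<gamma> t) - g (\<eta> t)) \<le> \<omega>"
  shows "AC_norm (\<lambda>t. p (\<gamma> t) - p (\<eta> t)) \<le> B * AC_dist \<gamma> \<eta> + \<omega>"
proof -
  note fund\<gamma> = abs_continuous_on_fundamental[OF Gamma_barD(1)[OF \<gamma>]]
  note fund\<eta> = abs_continuous_on_fundamental[OF Gamma_barD(1)[OF \<eta>]]
  have chain: "((\<lambda>t. p (\<gamma> t)) has_vector_derivative d *\<^sub>R g (\<gamma> t)) (at t within I01)"
    if \<gamma>: "\<gamma> \<in> Gamma_bar" and d: "(\<gamma> has_vector_derivative d) (at t within I01)" "t \<in> I01" for \<gamma> t d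
  proof -
    have img: "\<gamma> ` I01 \<subseteq> I01" using Gamma_barD(2)[OF \<gamma>] by auto
    then have "(p has_vector_derivative g (\<gamma> t)) (at (\<gamma> t) within \<gamma> ` I01)"
      using deriv[of "\<gamma> t"] d(2) has_vector_derivative_within_subset by blast
    from vector_diff_chain_within[OF d(1) this] show ?thesis by (simp add: o_def)
  qed
  define h where "h = (\<lambda>t. p (\<gamma> t) - p (\<eta> t))"
  have ach: "abs_continuous_on I01 h"
    unfolding h_def by (intro abs_continuous_on_diff Gamma_bar_compose(1)[OF p \<gamma>] Gamma_bar_compose(1)[OF p \<eta>])
  note fundh = abs_continuous_on_fundamental[OF ach]
  have ac\<gamma>\<eta>: "abs_continuous_on I01 (\<lambda>t. \<gamma> t - \<eta> t)"
    by (intro abs_continuous_on_diff Gamma_barD \<gamma> \<eta>)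
  have dist: "AC_dist \<gamma> \<eta> = (\<integral>t. norm (D01 \<gamma> t - D01 \<eta> t) \<partial>lebesgue_on I01)"
    unfolding AC_dist_def
  proof (rule AC_norm_eq_integral[OF ac\<gamma>\<eta>])
    show "AE t in lebesgue_on I01. ((\<lambda>t. \<gamma> t - \<eta> t) has_vector_derivative D01 \<gamma> t - D01 \<eta> t) (at t within I01)"
      using fund\<gamma>(1) fund\<eta>(1) by eventually_elim (rule has_vector_derivative_diff)
  qed (use fund\<gamma>(2) fund\<eta>(2) in simp)
  have int: "integrable (lebesgue_on I01) (\<lambda>t. B * norm (D01 \<gamma> t - D01 \<eta> t))"
    using fund\<gamma>(2) fund\<eta>(2)
    by (intro integrable_mult_right integrable_norm Bochner_Integration.integrable_diff)
  have int': "integrable (lebesgue_on I01) (\<lambda>t. \<omega> * D01 \<eta> t)"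
    using fund\<eta>(2) by (intro integrable_mult_right)
  have "AE t in lebesgue_on I01. norm (D01 h t) \<le> B * norm (D01 \<gamma> t - D01 \<eta> t) + \<omega> * D01 \<eta> t"
    using fund\<gamma>(1) fund\<eta>(1) Gamma_barD(5)[OF \<eta>] AE_space
  proof eventually_elim
    case (elim t)
    then have t: "t \<in> I01" by simp
    then have \<gamma>t: "\<gamma> t \<in> I01" using Gamma_barD(2)[OF \<gamma>] by blast
    have "(h has_vector_derivative (D01 \<gamma> t *\<^sub>R g (\<gamma> t) - D01 \<eta> t *\<^sub>R g (\<eta> t))) (at t within I01)"
      unfolding h_def by (intro has_vector_derivative_diff chain \<gamma> \<eta> elim(1,2) t)
    then have "D01 h t = D01 \<gamma> t *\<^sub>R g (\<gamma> t) - D01 \<eta> t *\<^sub>R g (\<eta> t)"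
      using t by (rule D01_eq)
    also have "\<dots> = (D01 \<gamma> t - D01 \<eta> t) *\<^sub>R g (\<gamma> t) + D01 \<eta> t *\<^sub>R (g (\<gamma> t) - g (\<eta> t))"
      by (simp add: algebra_simps)
    also have "norm \<dots> \<le> norm (D01 \<gamma> t - D01 \<eta> t) * norm (g (\<gamma> t)) + D01 \<eta> t * norm (g (\<gamma> t) - g (\<eta> t))"
      using norm_triangle_ineq elim(3) by (metis abs_of_nonneg norm_scaleR real_norm_def)
    also have "\<dots> \<le> norm (D01 \<gamma> t - D01 \<eta> t) * B + D01 \<eta> t * \<omega>"
      using elim(3) B[OF \<gamma>t] \<omega>[OF t] by (intro add_mono mult_left_mono) auto
    finally show ?case by (simp add: mult.commute)
  qed
  then have "AC_norm h \<le> (\<integral>t. B * norm (D01 \<gamma> t - D01 \<eta> t) + \<omega> * D01 \<eta> t \<partial>lebesgue_on I01)"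
    unfolding AC_norm_def
    by (intro integral_mono_AE integrable_norm fundh(2) Bochner_Integration.integrable_add int int')
  also have "\<dots> = B * AC_dist \<gamma> \<eta> + \<omega> * (\<integral>t. D01 \<eta> t \<partial>lebesgue_on I01)"
    unfolding dist using int int' by simp
  also have "(\<integral>t. D01 \<eta> t \<partial>lebesgue_on I01) = 1"
    using lebesgue_integral_eq_integral[OF fund\<eta>(2)] integral_unique[OF fund\<eta>(3)[of 0 1]]
      Gamma_barD(3,4)[OF \<eta>] by simp
  finally show ?thesis by (simp add: h_def)
qed

lemma compose_in_AC0:
  fixes c :: "real \<Rightarrow> 'a::euclidean_space"
  assumes c: "c \<in> AC0" and \<gamma>: "\<gamma> \<in> Gamma_bar"
  shows "compose I01 c \<gamma> \<in> AC0"
proof -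
  have "abs_continuous_on I01 (\<lambda>t. c (\<gamma> t))"
    using c by (intro Gamma_bar_compose(1)[OF _ \<gamma>]) (simp add: AC0_def)
  then have "abs_continuous_on I01 (compose I01 c \<gamma>)"
    by (rule abs_continuous_on_dominated[where C = 1]) (auto simp: compose_def subset_iff)
  then show ?thesis
    using c Gamma_barD(3)[OF \<gamma>] by (auto simp: AC0_def compose_def)
qed

text \<open>
  The extensional composition differs from the plain one only off the unit interval, where the norm does not
  look.
\<close>

lemma AC_dist_compose:
  fixes c e :: "real \<Rightarrow> 'a::euclidean_space"
  assumes c: "c \<in> AC0" and e: "e \<in> AC0" and \<gamma>: "\<gamma> \<in> Gamma_bar" and \<eta>: "\<eta> \<in> Gamma_bar"
  shows "AC_dist (compose I01 c \<gamma>) (compose I01 e \<eta>) \<le> AC_norm (\<lambda>t. c (\<gamma> t) - e (\<eta> t))"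
  unfolding AC_dist_def
proof (rule AC_norm_mono)
  show "abs_continuous_on I01 (\<lambda>t. c (\<gamma> t) - e (\<eta> t))"
    using c e
    by (intro abs_continuous_on_diff Gamma_bar_compose(1)[OF _ \<gamma>] Gamma_bar_compose(1)[OF _ \<eta>])
      (simp_all add: AC0_def)
  show "abs_continuous_on I01 (\<lambda>t. compose I01 c \<gamma> t - compose I01 e \<eta> t)"
    using compose_in_AC0[OF c \<gamma>] compose_in_AC0[OF e \<eta>]
    by (intro abs_continuous_on_diff) (auto simp: AC0_def)
qed (simp add: compose_def)

text \<open>
  The path from \<open>c0 \<circ> \<gamma>0\<close> to \<open>c \<circ> \<gamma>\<close> goes through \<open>p \<circ> \<gamma>0\<close>, \<open>p \<circ> \<gamma>\<close> and \<open>c0 \<circ> \<gamma>\<close>.  Three of the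
  four steps cost at most \<open>e/5\<close> since composition does not increase the norm; the step from \<open>\<gamma>0\<close> to
  \<open>\<gamma>\<close> costs two such portions.
\<close>

lemma continuous_action_estimate:
  fixes c0 :: "real \<Rightarrow> 'a::euclidean_space"
  assumes c0: "c0 \<in> AC0" and \<gamma>0: "\<gamma>0 \<in> Gamma_bar" and e: "e > 0"
  obtains d where "d > 0" "\<And>c \<gamma>. \<lbrakk>c \<in> AC0; \<gamma> \<in> Gamma_bar; AC_dist c0 c < d; AC_dist \<gamma>0 \<gamma> < d\<rbrakk>
    \<Longrightarrow> AC_dist (compose I01 c0 \<gamma>0) (compose I01 c \<gamma>) < e"
proof -
  have ac0: "abs_continuous_on I01 c0" using c0 by (simp add: AC0_def)
  have "e / 5 > 0" using e by simp
  from AC_approx_smooth[OF ac0 this] obtain p g where g: "continuous_on I01 g"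
    and deriv: "\<And>x. x \<in> I01 \<Longrightarrow> (p has_vector_derivative g x) (at x within I01)"
    and acp: "abs_continuous_on I01 p" and close: "AC_norm (\<lambda>t. c0 t - p t) < e / 5"
    by metis
  have "bounded (g ` I01)"
    by (intro compact_imp_bounded compact_continuous_image g) simp
  then obtain B where B: "B > 0" "\<And>t. t \<in> I01 \<Longrightarrow> norm (g t) \<le> B"
    unfolding bounded_pos by auto
  have "uniformly_continuous_on I01 g"
    by (rule compact_uniformly_continuous[OF g]) simp
  then obtain r where r: "r > 0"
    "\<And>x y. \<lbrakk>x \<in> I01; y \<in> I01; dist y x < r\<rbrakk> \<Longrightarrow> dist (g y) (g x) < e / 5"
    using \<open>e / 5 > 0\<close> unfolding uniformly_continuous_on_def by metis
  \<comment> \<open>The three bounds serve the step from \<open>c0\<close> to \<open>c\<close>, the uniform continuity of \<open>g\<close> and the factor \<open>B\<close>.\<close>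
  define d where "d = min (e / 5) (min r (e / (5 * B)))"
  have d: "d > 0" "d \<le> e / 5" "d \<le> r"
    using e r(1) B(1) by (auto simp: d_def)
  have Bd: "B * d \<le> e / 5"
  proof -
    have "d \<le> e / (5 * B)" by (simp add: d_def)
    then show ?thesis using B(1) by (simp add: field_simps)
  qed
  show thesis
  proof (rule that[OF d(1)])
    fix c \<gamma> assume c: "c \<in> (AC0 :: (real \<Rightarrow> 'a) set)" and \<gamma>: "\<gamma> \<in> Gamma_bar"
      and cd: "AC_dist c0 c < d" and \<gamma>d: "AC_dist \<gamma>0 \<gamma> < d"
    have ac: "abs_continuous_on I01 c" using c by (simp add: AC0_def)
    note comp = Gamma_bar_compose(1)[OF _ \<gamma>] Gamma_bar_compose(1)[OF _ \<gamma>0]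
    have 1: "AC_norm (\<lambda>t. c0 (\<gamma>0 t) - p (\<gamma>0 t)) < e / 5"
      using Gamma_bar_compose(2)[OF abs_continuous_on_diff[OF ac0 acp] \<gamma>0] close by simp
    have 2: "AC_norm (\<lambda>t. p (\<gamma>0 t) - p (\<gamma> t)) \<le> B * AC_dist \<gamma>0 \<gamma> + e / 5"
    proof (rule AC_norm_compose_diff_le[OF acp deriv B(2) \<gamma>0 \<gamma>])
      fix t :: real assume t: "t \<in> I01"
      have "norm ((\<gamma>0 t - \<gamma> t) - (\<gamma>0 0 - \<gamma> 0)) \<le> AC_dist \<gamma>0 \<gamma>"
        unfolding AC_dist_def
        by (rule norm_diff_le_AC_norm[OF abs_continuous_on_diff[OF Gamma_barD(1)[OF \<gamma>0] Gamma_barD(1)[OF \<gamma>]] t])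
      then have "dist (\<gamma>0 t) (\<gamma> t) < r"
        using Gamma_barD(3)[OF \<gamma>0] Gamma_barD(3)[OF \<gamma>] \<gamma>d d(3) by (simp add: dist_norm)
      moreover have "\<gamma>0 t \<in> I01" "\<gamma> t \<in> I01"
        using t Gamma_barD(2)[OF \<gamma>0] Gamma_barD(2)[OF \<gamma>] by blast+
      ultimately show "norm (g (\<gamma>0 t) - g (\<gamma> t)) \<le> e / 5"
        using r(2) by (simp add: dist_norm less_imp_le)
    qed
    have 3: "AC_norm (\<lambda>t. p (\<gamma> t) - c0 (\<gamma> t)) < e / 5"
      using Gamma_bar_compose(2)[OF abs_continuous_on_diff[OF acp ac0] \<gamma>] close
        AC_dist_commute[of c0 p] by (simp add: AC_dist_def)
    have 4: "AC_norm (\<lambda>t. c0 (\<gamma> t) - c (\<gamma> t)) < e / 5"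
      using Gamma_bar_compose(2)[OF abs_continuous_on_diff[OF ac0 ac] \<gamma>] cd d(2) by (simp add: AC_dist_def)
    have "B * AC_dist \<gamma>0 \<gamma> \<le> B * d"
      using \<gamma>d B(1) by (intro mult_left_mono) auto
    then have 5: "B * AC_dist \<gamma>0 \<gamma> \<le> e / 5"
      using Bd by (rule order.trans)
    have "AC_dist (compose I01 c0 \<gamma>0) (compose I01 c \<gamma>) \<le> AC_norm (\<lambda>t. c0 (\<gamma>0 t) - c (\<gamma> t))"
      by (rule AC_dist_compose[OF c0 c \<gamma>0 \<gamma>])
    also have "\<dots> \<le> AC_norm (\<lambda>t. c0 (\<gamma>0 t) - p (\<gamma>0 t)) + AC_norm (\<lambda>t. p (\<gamma>0 t) - c (\<gamma> t))"
      by (intro AC_norm_triangle comp ac0 ac acp)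
    also have "AC_norm (\<lambda>t. p (\<gamma>0 t) - c (\<gamma> t))
        \<le> AC_norm (\<lambda>t. p (\<gamma>0 t) - p (\<gamma> t)) + AC_norm (\<lambda>t. p (\<gamma> t) - c (\<gamma> t))"
      by (intro AC_norm_triangle comp ac0 ac acp)
    also have "AC_norm (\<lambda>t. p (\<gamma> t) - c (\<gamma> t))
        \<le> AC_norm (\<lambda>t. p (\<gamma> t) - c0 (\<gamma> t)) + AC_norm (\<lambda>t. c0 (\<gamma> t) - c (\<gamma> t))"
      by (intro AC_norm_triangle comp ac0 ac acp)
    finally show "AC_dist (compose I01 c0 \<gamma>0) (compose I01 c \<gamma>) < e"
      using 1 2 3 4 5 by simp
  qed
qed

theorem proposition4p2:
  shows "continuous_map
    (prod_topology (AC0_topology :: (real \<Rightarrow> real ^ 'd) topology) Gamma_bar_topology)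
    (AC0_topology :: (real \<Rightarrow> real ^ 'd) topology)
    (\<lambda>(c, \<gamma>). compose I01 c \<gamma>)"
proof -
  interpret C: Metric_space "AC0 :: (real \<Rightarrow> real ^ 'd) set" AC_dist
    by (rule Metric_space_AC0)
  interpret G: Metric_space "AC0 :: (real \<Rightarrow> real) set" AC_dist
    by (rule Metric_space_AC0)
  show ?thesis
    unfolding AC0_topology_def Gamma_bar_topology_def C.continuous_map_to_metric
  proof (intro ballI allI impI)
    fix x :: "(real \<Rightarrow> real ^ 'd) \<times> (real \<Rightarrow> real)" and e :: real
    assume x: "x \<in> topspace (prod_topology C.mtopology (subtopology G.mtopology Gamma_bar))" and e: "e > 0"
    obtain c0 \<gamma>0 where x_eq: "x = (c0, \<gamma>0)" by (cases x)
    have c0: "c0 \<in> AC0" and \<gamma>0: "\<gamma>0 \<in> Gamma_bar" "\<gamma>0 \<in> AC0"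
      using x by (auto simp: x_eq)
    obtain d where d: "d > 0" "\<And>c \<gamma>. \<lbrakk>c \<in> AC0; \<gamma> \<in> Gamma_bar; AC_dist c0 c < d; AC_dist \<gamma>0 \<gamma> < d\<rbrakk>
        \<Longrightarrow> AC_dist (compose I01 c0 \<gamma>0) (compose I01 c \<gamma>) < e"
      using continuous_action_estimate[OF c0 \<gamma>0(1) e] by metis
    define U where "U = C.mball c0 d \<times> (G.mball \<gamma>0 d \<inter> Gamma_bar)"
    have "openin (prod_topology C.mtopology (subtopology G.mtopology Gamma_bar)) U"
      unfolding U_def openin_prod_Times_iff by (auto simp: openin_subtopology)
    moreover have "x \<in> U"
      using c0 \<gamma>0 d(1) by (simp add: U_def x_eq)
    moreover have "\<forall>y\<in>U. (case y of (c, \<gamma>) \<Rightarrow> compose I01 c \<gamma>) \<in>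
        C.mball (case x of (c, \<gamma>) \<Rightarrow> compose I01 c \<gamma>) e"
      using d(2) compose_in_AC0 c0 \<gamma>0 by (auto simp: U_def x_eq)
    ultimately show "\<exists>U. openin (prod_topology C.mtopology (subtopology G.mtopology Gamma_bar)) U \<and> x \<in> U \<and>
        (\<forall>y\<in>U. (case y of (c, \<gamma>) \<Rightarrow> compose I01 c \<gamma>) \<in> C.mball (case x of (c, \<gamma>) \<Rightarrow> compose I01 c \<gamma>) e)"
      by blast
  qed
qed

end
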